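(* Let $\mathcal R$ be any convex ML region and let $$C^\star(\mathcal R)=\max_{C\ge0,\ p:[0,\bar x]\to\mathbb R} C\quad\text{s.t.}\quad \widetilde l(x;C)\le p(x)\le u(x;C)\ \ \forall x\in[\underline x,\bar x],\quad p\ge0 \text{ continuous on }[0,\bar x],\quad -1\le p'(x)\le 0 \text{ a.e. on }[0,\bar x].$$ Then the consistent ratio of every (deterministic or randomized) online algorithm under ML region $\mathcal R$ is at most $C^\star(\mathcal R)$. Furthermore, $C^\star(\mathcal R)\ge \rho$, where $\rho=\frac{1}{2-r_\ell/r_h}$.
   Context: Setting. A firm holds $m>0$ units of a divisible resource. Requests arrive sequentially; request $t$ has size $s_t>0$ and type $z_t\in\{\ell,h\}$; each unit given to a type-$z$ request yields reward $r_z$, $0<r_\ell<r_h$. On arrival the firm irrevocably allocates $a_t\in[0,s_t]$ units (at most the remaining inventory) without knowledge of future requests; the arrival sequence (number, sizes, types, order) is arbitrary. For a sequence $I$, $\ell(I),h(I)$ are the total low/high-reward demands, $\mathrm{OPT}(I)=\min\{h(I),m\}r_h+\min\{\ell(I),(m-h(I))^+\}r_\ell$, and $\mathrm{Rew}(\mathcal A,I)$ is the expected reward of online algorithm $\mathcal A$. ML advice: a convex set $\mathcal R\subset\mathbb R^2$ of demand vectors $(x,y)$ ($x$ low-, $y$ high-reward demand). The consistent ratio of $\mathcal A$ is $\inf\{\mathrm{Rew}(\mathcal A,I)/\mathrm{OPT}(I):(\ell(I),h(I))\in\mathcal R\}$. Region notation: $\underline x=\inf_{(x,y)\in\mathcal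 R}x$, $\bar x=\sup_{(x,y)\in\mathcal R}x$; for $x\in[\underline x,\bar x]$, $\bar h(x)=\sup\{y:(x,y)\in\mathcal R\}$, $\underline h(x)=\inf\{y:(x,y)\in\mathcal R\}$; $\underline{\mathcal H}(x)=\min\{\underline h(x),m\}$; $\overline{\mathcal R}=\{(x,y)\in\mathcal R:y=\sup_{(x',y')\in\mathcal R}\min\{y',m\}\}$, $\underline{\mathcal R}=\{(x,y)\in\mathcal R:y=\inf_{(x',y')\in\mathcal R}\min\{y',m\}\}$; $L=(x_L,y_L)$ is the point of $\underline{\mathcal R}$ with smallest first coordinate, $H=(x_H,y_H)$ the point of $\overline{\mathcal R}$ with largest first coordinate. Compatible ratios for $p\in[0,m]$, $x,y\ge0$: $\mathrm{CP}_o(p;(x,y))=\frac{\min\{y,m\}r_h+\min\{x,(m-p)^+\}r_\ell}{\min\{y,m\}r_h+\min\{x,(m-y)^+\}r_\ell}$, $\mathrm{CP}_u(p;(x,y))=\frac{\max\{p,\min\{y,(m-x)^+\}\}r_h+\min\{x,m-p\}r_\ell}{\min\{y,m\}r_h+\min\{x,(m-y)^+\}r_\ell}$. Upper bound $u(\cdot;C)$: $\bar x_u=x_L$ if $x_L+y_L\ge m$, else $\bar x_u=\sup\{x\in[x_L,\bar x]:(1-C)\frac{r_h}{r_\ell}\underline{\mathcal H}'(x^-)-C<0\}$; $\underline x_u=\sup\{x\in(\underline x,\bar x_u):\mathrm{CP}_o(m;(x,\underline h(x)))\ge C\}$ ($=\underline x$ if empty); $u(x;C)=\sup\{p\in[0,m]:\mathrm{CP}_o(p;(x,\underline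 h(x)))=C\}$ on $[\underline x_u,\bar x_u]$, $u(x;C)=m$ on $[0,\underline x_u]$, $u(x;C)=u(\bar x_u;C)$ on $[\bar x_u,\bar x]$. Lower bound: $\bar x_l=\inf\{x\in(x_H,\bar x):\mathrm{CP}_u(0;(x,\bar h(x)))\ge C\}$ ($=\bar x$ if empty); $l(x;C)=\inf\{p\in[0,m]:\mathrm{CP}_u(p;(x,\bar h(x)))=C\}$ on $[x_H,\bar x_l]$, $l(x;C)=l(x_H;C)$ on $[0,x_H]$, $l(x;C)=0$ on $[\bar x_l,\bar x]$. With $x_{-1}=\sup\{x\in[x_H,\bar x]:\partial_x l(x^-;C)\le-1\}$ (set to $\bar x$ when $\partial_x l(x^-;C)\ge-1$ on all of $[x_H,\bar x]$): $\widetilde l(x;C)=l(x;C)$ on $[0,x_{-1}]$ and $\widetilde l(x;C)=(l(x_{-1};C)-(x-x_{-1}))^+$ on $[x_{-1},\bar x]$.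
   Formalization: The convex ML region is taken nonempty and compact in the nonnegative quadrant (otherwise L, H may not exist), the max defining C* is read as a supremum since it may not be attained, p is also required to be Lipschitz, and conventions fix 0/0 = 1, empty sets and overlapping pieces of u and l. *)

theory Defs
  imports "HOL-Probability.Probability"
begin

section \<open>Online allocation\<close>

datatype rtype = Low | High

type_synonym request = "real \<times> rtype"  \<comment> \<open>(size, type)\<close>

definition valid_instance :: "request list \<Rightarrow> bool" where
  "valid_instance I \<longleftrightarrow> (\<forall>q\<in>set I. 0 < fst q)"

definition demand :: "rtype \<Rightarrow> request list \<Rightarrow> real" where
  "demand z I = (\<Sum>q\<leftarrow>I. if snd q = z then fst q else 0)"

fun unit_reward :: "real \<Rightarrow> real \<Rightarrow> rtype \<Rightarrow> real" where
  "unit_reward rl rh Low = rl"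
| "unit_reward rl rh High = rh"

definition opt :: "real \<Rightarrow> real \<Rightarrow> real \<Rightarrow> real \<times> real \<Rightarrow> real" where
  "opt m rl rh = (\<lambda>(x, y). min y m * rh + min x (max 0 (m - y)) * rl)"

definition OPT :: "real \<Rightarrow> real \<Rightarrow> real \<Rightarrow> request list \<Rightarrow> real" where
  "OPT m rl rh I = opt m rl rh (demand Low I, demand High I)"

text \<open>
  A deterministic online algorithm maps the prefix of requests seen so far (the current
  request being the last one) to the allocation of the current request. Past allocations are
  determined by the proper prefixes, so they need not be passed as an argument.
\<close>

definition allocation :: "(request list \<Rightarrow> real) \<Rightarrow> request list \<Rightarrow> nat \<Rightarrow> real" where
  "allocation A I t = A (take (Suc t) I)"

definition online_algorithm :: "real \<Rightarrow> (request list \<Rightarrow> real) \<Rightarrow> bool" where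
  "online_algorithm m A \<longleftrightarrow>
     (\<forall>I. valid_instance I \<longrightarrow>
        (\<forall>t<length I. 0 \<le> allocation A I t \<and> allocation A I t \<le> fst (I ! t)
           \<and> allocation A I t \<le> m - (\<Sum>i<t. allocation A I i)))"

definition reward :: "real \<Rightarrow> real \<Rightarrow> (request list \<Rightarrow> real) \<Rightarrow> request list \<Rightarrow> real" where
  "reward rl rh A I = (\<Sum>t<length I. unit_reward rl rh (snd (I ! t)) * allocation A I t)"

text \<open>
  A randomized online algorithm is a random deterministic one.
\<close>

definition randomized_online_algorithm ::
    "real \<Rightarrow> 'w measure \<Rightarrow> ('w \<Rightarrow> request list \<Rightarrow> real) \<Rightarrow> bool" where
  "randomized_online_algorithm m M A \<longleftrightarrow>
     prob_space M \<and> (\<forall>\<omega>\<in>space M. online_algorithm m (A \<omega>))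
     \<and> (\<forall>I. valid_instance I \<and> I \<noteq> [] \<longrightarrow> (\<lambda>\<omega>. A \<omega> I) \<in> borel_measurable M)"

definition expected_reward ::
    "real \<Rightarrow> real \<Rightarrow> 'w measure \<Rightarrow> ('w \<Rightarrow> request list \<Rightarrow> real) \<Rightarrow> request list \<Rightarrow> real" where
  "expected_reward rl rh M A I = (\<integral>\<omega>. reward rl rh (A \<omega>) I \<partial>M)"

text \<open>
  All ratios below have an optimal reward as denominator, which vanishes only for the demand
  vector \<open>(0, 0)\<close>. The ratio is then 1 rather than the value 0 of division by zero.
\<close>

definition ratio :: "real \<Rightarrow> real \<Rightarrow> real" where
  "ratio a b = (if b = 0 then 1 else a / b)"

text \<open>
  The argument \<open>Rew\<close> is the (expected) reward of the algorithm as a function of the instance.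
\<close>

definition consistent_ratio ::
    "real \<Rightarrow> real \<Rightarrow> real \<Rightarrow> (real \<times> real) set \<Rightarrow> (request list \<Rightarrow> real) \<Rightarrow> real" where
  "consistent_ratio m rl rh R Rew =
     Inf {ratio (Rew I) (OPT m rl rh I) | I.
            valid_instance I \<and> (demand Low I, demand High I) \<in> R}"


section \<open>Geometry of the region\<close>

definition xmin :: "(real \<times> real) set \<Rightarrow> real" where
  "xmin R = Inf (fst ` R)"

definition xmax :: "(real \<times> real) set \<Rightarrow> real" where
  "xmax R = Sup (fst ` R)"

definition hup :: "(real \<times> real) set \<Rightarrow> real \<Rightarrow> real" where
  "hup R x = Sup {y. (x, y) \<in> R}"

definition hlow :: "(real \<times> real) set \<Rightarrow> real \<Rightarrow> real" where
  "hlow R x = Inf {y. (x, y) \<in> R}"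

definition hlow_cap :: "real \<Rightarrow> (real \<times> real) set \<Rightarrow> real \<Rightarrow> real" where
  "hlow_cap m R x = min (hlow R x) m"

definition y_H :: "real \<Rightarrow> (real \<times> real) set \<Rightarrow> real" where
  "y_H m R = (SUP q\<in>R. min (snd q) m)"

definition y_L :: "real \<Rightarrow> (real \<times> real) set \<Rightarrow> real" where
  "y_L m R = (INF q\<in>R. min (snd q) m)"

definition R_top :: "real \<Rightarrow> (real \<times> real) set \<Rightarrow> (real \<times> real) set" where
  "R_top m R = {q \<in> R. snd q = y_H m R}"

definition R_bottom :: "real \<Rightarrow> (real \<times> real) set \<Rightarrow> (real \<times> real) set" where
  "R_bottom m R = {q \<in> R. snd q = y_L m R}"

text \<open>
  For compact convex \<open>R\<close> the sets \<open>R_top\<close> and \<open>R_bottom\<close> are empty only if \<open>R\<close> lies strictly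
  above height \<open>m\<close>. Capped at \<open>m\<close>, all points of \<open>R\<close> then have the same second coordinate, and
  \<open>R\<close> itself takes the place of the empty set.
\<close>

definition x_H :: "real \<Rightarrow> (real \<times> real) set \<Rightarrow> real" where
  "x_H m R = Sup (fst ` (if R_top m R = {} then R else R_top m R))"

definition x_L :: "real \<Rightarrow> (real \<times> real) set \<Rightarrow> real" where
  "x_L m R = Inf (fst ` (if R_bottom m R = {} then R else R_bottom m R))"


section \<open>Compatible ratios and the bounds on the protection level\<close>

definition CP_o :: "real \<Rightarrow> real \<Rightarrow> real \<Rightarrow> real \<Rightarrow> real \<times> real \<Rightarrow> real" where
  "CP_o m rl rh p = (\<lambda>(x, y).
     ratio (min y m * rh + min x (max 0 (m - p)) * rl) (opt m rl rh (x, y)))"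

definition CP_u :: "real \<Rightarrow> real \<Rightarrow> real \<Rightarrow> real \<Rightarrow> real \<times> real \<Rightarrow> real" where
  "CP_u m rl rh p = (\<lambda>(x, y).
     ratio (max p (min y (max 0 (m - x))) * rh + min x (m - p) * rl) (opt m rl rh (x, y)))"

text \<open>
  Left derivative, with infinite values allowed: \<open>hlow_cap\<close> may have a vertical tangent at the
  right end of its domain, and the lower bound may jump down to 0.
\<close>

definition has_left_deriv :: "(real \<Rightarrow> real) \<Rightarrow> real \<Rightarrow> ereal \<Rightarrow> bool" where
  "has_left_deriv f x D \<longleftrightarrow>
     ((\<lambda>t. ereal ((f t - f x) / (t - x))) \<longlongrightarrow> D) (at_left x)"

text \<open>
  Inserting an end point into a set under \<open>Sup\<close> or \<open>Inf\<close> only fixes the value for the empty set.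
  In particular, suprema and infima of sets of protection levels are taken in \<open>{0..m}\<close>.
  The case \<open>x = xmin R\<close> is excluded below because there is no left derivative of \<open>hlow_cap\<close> at
  the left end of its domain.
\<close>

definition xbar_u ::
    "real \<Rightarrow> real \<Rightarrow> real \<Rightarrow> (real \<times> real) set \<Rightarrow> real \<Rightarrow> real" where
  "xbar_u m rl rh R C =
     (if m \<le> x_L m R + y_L m R then x_L m R
      else Sup (insert (x_L m R)
        {x \<in> {x_L m R..xmax R}. xmin R < x \<and>
           (\<exists>D. has_left_deriv (hlow_cap m R) x D \<and>
                ereal ((1 - C) * (rh / rl)) * D - ereal C < 0)}))"

definition xund_u ::
    "real \<Rightarrow> real \<Rightarrow> real \<Rightarrow> (real \<times> real) set \<Rightarrow> real \<Rightarrow> real" where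
  "xund_u m rl rh R C =
     Sup (insert (xmin R)
       {x \<in> {xmin R<..<xbar_u m rl rh R C}. C \<le> CP_o m rl rh m (x, hlow R x)})"

text \<open>
  The first two pieces of the upper bound meet at \<open>xund_u\<close>. They agree there, except possibly if
  the set in the definition of \<open>xund_u\<close> is empty. In that case the value at \<open>xund_u\<close> is \<open>m\<close> if
  full protection is compatible with the ratio \<open>C\<close> there, and the solution of the equation
  otherwise. The lower bound treats the point \<open>xbar_l\<close> in the same way.
\<close>

definition u_bound ::
    "real \<Rightarrow> real \<Rightarrow> real \<Rightarrow> (real \<times> real) set \<Rightarrow> real \<Rightarrow> real \<Rightarrow> real" where
  "u_bound m rl rh R C x =
     (let z = min x (xbar_u m rl rh R C) in
      if z < xund_u m rl rh R C
         \<or> z = xund_u m rl rh R C \<and> C \<le> CP_o m rl rh m (z, hlow R z)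
      then m
      else Sup (insert 0 {p \<in> {0..m}. CP_o m rl rh p (z, hlow R z) = C}))"

definition xbar_l ::
    "real \<Rightarrow> real \<Rightarrow> real \<Rightarrow> (real \<times> real) set \<Rightarrow> real \<Rightarrow> real" where
  "xbar_l m rl rh R C =
     Inf (insert (xmax R)
       {x \<in> {x_H m R<..<xmax R}. C \<le> CP_u m rl rh 0 (x, hup R x)})"

definition l_bound ::
    "real \<Rightarrow> real \<Rightarrow> real \<Rightarrow> (real \<times> real) set \<Rightarrow> real \<Rightarrow> real \<Rightarrow> real" where
  "l_bound m rl rh R C x =
     (let z = max x (x_H m R) in
      if xbar_l m rl rh R C < z
         \<or> z = xbar_l m rl rh R C \<and> C \<le> CP_u m rl rh 0 (z, hup R z)
      then 0
      else Inf (insert m {p \<in> {0..m}. CP_u m rl rh p (z, hup R z) = C}))"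

definition x_minus_one ::
    "real \<Rightarrow> real \<Rightarrow> real \<Rightarrow> (real \<times> real) set \<Rightarrow> real \<Rightarrow> real" where
  "x_minus_one m rl rh R C =
     (if \<forall>x\<in>{x_H m R..xmax R}. \<forall>D. has_left_deriv (l_bound m rl rh R C) x D \<longrightarrow> -1 \<le> D
      then xmax R
      else Sup {x \<in> {x_H m R..xmax R}.
                  \<exists>D. has_left_deriv (l_bound m rl rh R C) x D \<and> D \<le> -1})"

definition l_tilde ::
    "real \<Rightarrow> real \<Rightarrow> real \<Rightarrow> (real \<times> real) set \<Rightarrow> real \<Rightarrow> real \<Rightarrow> real" where
  "l_tilde m rl rh R C x =
     (let x1 = x_minus_one m rl rh R C in
      if x \<le> x1 then l_bound m rl rh R C x
      else max 0 (l_bound m rl rh R C x1 - (x - x1)))"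


section \<open>The optimization problem\<close>

text \<open>
  The Lipschitz condition makes \<open>p\<close> the integral of its almost everywhere derivative. Without it,
  the bounds on the derivative would not exclude singular functions such as the Cantor function,
  whose derivative is 0 almost everywhere.
\<close>

definition feasible ::
    "real \<Rightarrow> real \<Rightarrow> real \<Rightarrow> (real \<times> real) set \<Rightarrow> real \<Rightarrow> (real \<Rightarrow> real) \<Rightarrow> bool" where
  "feasible m rl rh R C p \<longleftrightarrow>
     0 \<le> C
     \<and> (\<forall>x\<in>{xmin R..xmax R}. l_tilde m rl rh R C x \<le> p x \<and> p x \<le> u_bound m rl rh R C x)
     \<and> (\<forall>x\<in>{0..xmax R}. 0 \<le> p x)
     \<and> continuous_on {0..xmax R} p
     \<and> (\<exists>K. K-lipschitz_on {0..xmax R} p)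
     \<and> (AE x in lebesgue. x \<in> {0..xmax R} \<longrightarrow>
          (\<exists>D. (p has_real_derivative D) (at x) \<and> -1 \<le> D \<and> D \<le> 0))"

text \<open>
  The optimal value is a supremum. It need not be attained: \<open>xbar_l\<close> can jump as a function of
  \<open>C\<close>.
\<close>

definition C_star :: "real \<Rightarrow> real \<Rightarrow> real \<Rightarrow> (real \<times> real) set \<Rightarrow> real" where
  "C_star m rl rh R = Sup {C. \<exists>p. feasible m rl rh R C p}"

end

theory Submission
  imports Defs
begin

text \<open>
  Feed an algorithm infinitesimal low requests up to demand \<open>x\<close> and then high demand \<open>y\<close>. The amount
  \<open>q x\<close> that it allocates to the low requests is nondecreasing and 1-Lipschitz in \<open>x\<close>, and a consistent
  ratio \<open>C\<close> forces \<open>q x * rl + min y (m - q x) * rh\<close> to be at least \<open>C\<close> times the optimum on the whole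
  region. Taken at the upper and the lower end of each vertical section, this says that both
  compatible ratios of \<open>p x = m - q x\<close> are at least \<open>C\<close>, so \<open>p\<close> lies between the two bounds and is
  feasible. Randomization does not help because the reward is concave in \<open>q x\<close>, so \<open>q\<close> may be replaced
  by its expectation. For the lower bound on the optimal value, \<open>q x = min x (m * \<rho>)\<close> achieves the
  ratio \<open>\<rho>\<close> on every instance.
\<close>

section \<open>Compatible ratios\<close>

text \<open>For \<open>b = 0\<close> the ratio has its default value 1, and \<open>C \<le> 1\<close>
  makes both sides true. This is the source of the condition \<open>C \<le> 1\<close> wherever ratio
  inequalities are cleared of denominators below.\<close>

lemma le_ratio_iff:
  assumes "0 \<le> a" "0 \<le> b" "C \<le> 1"
  shows "C \<le> ratio a b \<longleftrightarrow> C * b \<le> a"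
  using assms by (auto simp: ratio_def field_simps)

section \<open>Estimates for the offline optimum and the compatible ratios\<close>

locale allocation_problem =
  fixes m rl rh :: real
  assumes m_pos: "0 < m" and rl_pos: "0 < rl" and rl_less_rh: "rl < rh"
begin

lemma rh_pos: "0 < rh"
  using rl_pos rl_less_rh by simp

lemma opt_nonneg: "0 \<le> x \<Longrightarrow> 0 \<le> y \<Longrightarrow> 0 \<le> opt m rl rh (x, y)"
  using m_pos rl_pos rh_pos by (simp add: opt_def)

text \<open>Serving low demand alone is one offline choice. The bound later turns an error
  proportional to low demand into an error relative to the optimum.\<close>

lemma min_le_opt:
  assumes "0 \<le> x" "0 \<le> y"
  shows "min x m * rl \<le> opt m rl rh (x, y)"
proof (cases "m \<le> y \<or> x \<le> m - y")
  case True
  have "min x m * rl \<le> m * rh"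
    using assms m_pos rl_pos rl_less_rh by (intro mult_mono) auto
  moreover have "min x m * rl \<le> y * rh + x * rl"
    using assms m_pos rl_pos rh_pos by (smt (verit) mult_nonneg_nonneg mult_right_mono)
  ultimately show ?thesis
    using True assms by (auto simp: opt_def min_def max_def)
next
  case False
  then have "y * rl \<le> y * rh"
    using assms rl_less_rh by (intro mult_left_mono) auto
  moreover have "min x m * rl \<le> m * rl"
    using rl_pos by simp
  ultimately show ?thesis
    using False assms by (auto simp: opt_def min_def max_def algebra_simps)
qed

text \<open>Each additional high unit displaces at most one low unit, which is worth less.\<close>

lemma opt_mono_high:
  assumes "0 \<le> x" "0 \<le> y" "y \<le> y'"
  shows "opt m rl rh (x, y) \<le> opt m rl rh (x, y')"
proof -
  have "(min x (max 0 (m - y)) - min x (max 0 (m - y'))) * rl \<le> (min y' m - min y m) * rl"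
    using assms rl_pos by (intro mult_right_mono) auto
  also have "\<dots> \<le> (min y' m - min y m) * rh"
    using assms rl_less_rh by (intro mult_left_mono) auto
  finally show ?thesis
    by (simp add: opt_def algebra_simps)
qed

lemma opt_pos: "0 \<le> x \<Longrightarrow> 0 \<le> y \<Longrightarrow> 0 < x \<Longrightarrow> 0 < opt m rl rh (x, y)"
  using min_le_opt[of x y] m_pos rl_pos by (smt (verit) mult_pos_pos)

lemma le_CP_o_iff:
  assumes "C \<le> 1" "0 \<le> x" "0 \<le> y"
  shows "C \<le> CP_o m rl rh p (x, y) \<longleftrightarrow>
    C * opt m rl rh (x, y) \<le> min y m * rh + min x (max 0 (m - p)) * rl"
  unfolding CP_o_def prod.case using assms m_pos rl_pos rh_pos
  by (intro le_ratio_iff) (auto simp: opt_nonneg)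

lemma le_CP_u_iff:
  assumes "C \<le> 1" "0 \<le> x" "0 \<le> y" "0 \<le> p" "p \<le> m"
  shows "C \<le> CP_u m rl rh p (x, y) \<longleftrightarrow>
    C * opt m rl rh (x, y) \<le> max p (min y (max 0 (m - x))) * rh + min x (m - p) * rl"
  unfolding CP_u_def prod.case using assms m_pos rl_pos rh_pos
  by (intro le_ratio_iff) (auto simp: opt_nonneg)

lemma continuous_on_CP_o: "continuous_on S (\<lambda>p. CP_o m rl rh p (x, y))"
  unfolding CP_o_def prod.case ratio_def
  by (cases "opt m rl rh (x, y) = 0") (auto intro!: continuous_intros)

lemma continuous_on_CP_u: "continuous_on S (\<lambda>p. CP_u m rl rh p (x, y))"
  unfolding CP_u_def prod.case ratio_def
  by (cases "opt m rl rh (x, y) = 0") (auto intro!: continuous_intros)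

text \<open>The optimum dominates the high reward alone and the low reward alone, and the numerator
  is at most the sum of the two.\<close>

lemma CP_o_le_2:
  assumes "0 \<le> x" "0 \<le> y" "0 \<le> p"
  shows "CP_o m rl rh p (x, y) \<le> 2"
proof -
  have "min x (max 0 (m - p)) * rl \<le> min x m * rl"
    using assms m_pos rl_pos by (intro mult_right_mono) auto
  moreover have "min y m * rh \<le> opt m rl rh (x, y)"
    using assms rl_pos by (simp add: opt_def)
  ultimately have "min y m * rh + min x (max 0 (m - p)) * rl \<le> 2 * opt m rl rh (x, y)"
    using min_le_opt[OF assms(1,2)] by linarith
  then show ?thesis
    using opt_nonneg[OF assms(1,2)] by (auto simp: CP_o_def ratio_def field_simps)
qed

text \<open>The numerator of \<open>CP_u\<close> pays for all \<open>p\<close> protected units at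
  rate \<open>rh\<close>, even when high demand is smaller. The ratio can therefore be arbitrarily
  large near the origin, and the bound has to depend on the point.\<close>

lemma CP_u_le:
  assumes "0 \<le> x" "0 \<le> y" "0 \<le> p" "p \<le> m"
  shows "CP_u m rl rh p (x, y) \<le> max 1 (m * (rh + rl) / opt m rl rh (x, y))"
proof -
  have "max p (min y (max 0 (m - x))) * rh + min x (m - p) * rl \<le> m * rh + m * rl"
    using assms m_pos rl_pos rh_pos by (intro add_mono mult_right_mono) auto
  then show ?thesis
    using opt_nonneg[OF assms(1,2)]
    by (auto simp: CP_u_def ratio_def le_max_iff_disj algebra_simps intro!: divide_right_mono)
qed

end

text \<open>
  An upper bound for the reward from high demand \<open>y\<close> that arrives after \<open>q\<close> units have gone to low
  requests. An algorithm facing infinitesimal low requests is described by \<open>q x\<close>, the units allocated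
  after low demand \<open>x\<close>; its protection level is \<open>p x = m - q x\<close>.
\<close>

definition low_first_reward :: "real \<Rightarrow> real \<Rightarrow> real \<Rightarrow> real \<Rightarrow> real \<Rightarrow> real" where
  "low_first_reward m rl rh q y = q * rl + min y (m - q) * rh"

section \<open>Low-first rewards compared with the optimum and the compatible ratios\<close>

context allocation_problem
begin

text \<open>Compare \<open>q\<close> with the number of low units that the optimum serves. Up to
  that number neither type earns more than in the optimum; every low unit beyond it takes the place
  of a high unit.\<close>

lemma low_first_reward_le_opt:
  assumes "0 \<le> x" "0 \<le> y" "0 \<le> q" "q \<le> x" "q \<le> m"
  shows "low_first_reward m rl rh q y \<le> opt m rl rh (x, y)"
proof -
  let ?d = "q - min x (max 0 (m - y))"
  show ?thesis
  proof (cases "?d \<le> 0")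
    case True
    then have "?d * rl \<le> 0"
      using rl_pos by (simp add: mult_nonpos_nonneg)
    moreover have "min y (m - q) * rh \<le> min y m * rh"
      using assms rh_pos by (intro mult_right_mono) auto
    ultimately show ?thesis
      by (simp add: low_first_reward_def opt_def algebra_simps)
  next
    case False
    then have "?d * rl \<le> ?d * rh"
      using rl_less_rh by (intro mult_left_mono) auto
    also have "\<dots> \<le> (min y m - min y (m - q)) * rh"
      using assms False rh_pos by (intro mult_right_mono) auto
    finally show ?thesis
      by (simp add: low_first_reward_def opt_def algebra_simps)
  qed
qed

text \<open>At \<open>p = m - q\<close> both compatible ratios credit at least the high units that
  \<open>q\<close> leaves room for: \<open>CP_o\<close> caps \<open>y\<close> at \<open>m\<close>
  instead of \<open>m - q\<close>, and \<open>CP_u\<close> counts at least \<open>m - q\<close> of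
  them.\<close>

lemma le_CP_o_low_first:
  assumes "C \<le> 1" "0 \<le> x" "0 \<le> y" "0 \<le> q" "q \<le> x" "q \<le> m"
    and "C * opt m rl rh (x, y) \<le> low_first_reward m rl rh q y"
  shows "C \<le> CP_o m rl rh (m - q) (x, y)"
proof -
  have "min y (m - q) * rh \<le> min y m * rh"
    using assms rh_pos by (intro mult_right_mono) auto
  then show ?thesis
    using assms by (simp add: le_CP_o_iff low_first_reward_def)
qed

lemma le_CP_u_low_first:
  assumes "C \<le> 1" "0 \<le> x" "0 \<le> y" "0 \<le> q" "q \<le> x" "q \<le> m"
    and "C * opt m rl rh (x, y) \<le> low_first_reward m rl rh q y"
  shows "C \<le> CP_u m rl rh (m - q) (x, y)"
proof -
  have "min y (m - q) * rh \<le> max (m - q) (min y (max 0 (m - x))) * rh"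
    using assms rh_pos by (intro mult_right_mono) auto
  then show ?thesis
    using assms by (simp add: le_CP_u_iff low_first_reward_def)
qed

end

section \<open>Sections of the region and the points that delimit the two bounds\<close>

locale ml_region = allocation_problem +
  fixes R :: "(real \<times> real) set"
  assumes convex_R: "convex R" and compact_R: "compact R" and nonempty_R: "R \<noteq> {}"
    and nonneg_R: "(x, y) \<in> R \<Longrightarrow> 0 \<le> x \<and> 0 \<le> y"
begin

lemma compact_fst: "compact (fst ` R)"
  by (intro compact_continuous_image continuous_intros compact_R)

lemma fst_image_R: "fst ` R = {xmin R..xmax R}"
proof -
  have bdd: "bdd_below (fst ` R)" "bdd_above (fst ` R)"
    using compact_imp_bounded[OF compact_fst]
    by (simp_all add: bounded_imp_bdd_below bounded_imp_bdd_above)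
  have "closed (fst ` R)" "fst ` R \<noteq> {}"
    using compact_imp_closed[OF compact_fst] nonempty_R by simp_all
  then have mem: "xmin R \<in> fst ` R" "xmax R \<in> fst ` R"
    unfolding xmin_def xmax_def using bdd by (simp_all add: closed_contains_Inf closed_contains_Sup)
  have interval: "is_interval (fst ` R)"
    by (simp add: is_interval_convex_1 convex_linear_image[OF linear_fst convex_R])
  show ?thesis
  proof (intro equalityI subsetI)
    fix x assume x: "x \<in> fst ` R"
    then show "x \<in> {xmin R..xmax R}"
      unfolding xmin_def xmax_def atLeastAtMost_iff
      using cInf_lower[OF x bdd(1)] cSup_upper[OF x bdd(2)] by blast
  next
    fix x assume "x \<in> {xmin R..xmax R}"
    then show "x \<in> fst ` R"
      using interval mem unfolding is_interval_1 atLeastAtMost_iff by blast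
  qed
qed

lemma mem_R_bounds: "(x, y) \<in> R \<Longrightarrow> x \<in> {xmin R..xmax R}"
  using fst_image_R by force

lemma xmin_le_xmax: "xmin R \<le> xmax R"
  using nonempty_R fst_image_R by force

lemma xmin_nonneg: "0 \<le> xmin R"
proof -
  have "xmin R \<in> fst ` R"
    using fst_image_R xmin_le_xmax by simp
  then show ?thesis
    using nonneg_R by auto
qed

lemma compact_section: "compact {y. (x, y) \<in> R}"
proof -
  have "{y. (x, y) \<in> R} = snd ` (R \<inter> {q. fst q = x})"
    by force
  moreover have "closed {q :: real \<times> real. fst q = x}"
    by (intro closed_Collect_eq continuous_intros)
  ultimately show ?thesis
    using compact_R by (auto intro!: compact_continuous_image continuous_intros compact_Int_closed)
qed

lemma section_bounds: "(x, y) \<in> R \<Longrightarrow> hlow R x \<le> y \<and> y \<le> hup R x"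
  unfolding hlow_def hup_def
  using compact_imp_bounded[OF compact_section[of x]]
  by (auto intro!: cInf_lower cSup_upper bounded_imp_bdd_above bounded_imp_bdd_below)

lemma section_nonempty: "x \<in> {xmin R..xmax R} \<Longrightarrow> {y. (x, y) \<in> R} \<noteq> {}"
  using fst_image_R by force

lemma hlow_mem:
  assumes "x \<in> {xmin R..xmax R}"
  shows "(x, hlow R x) \<in> R"
proof -
  have "Inf {y. (x, y) \<in> R} \<in> {y. (x, y) \<in> R}"
    using compact_section[of x] section_nonempty[OF assms]
    by (intro closed_contains_Inf bounded_imp_bdd_below compact_imp_closed compact_imp_bounded)
  then show ?thesis
    by (simp add: hlow_def)
qed

lemma hup_mem:
  assumes "x \<in> {xmin R..xmax R}"
  shows "(x, hup R x) \<in> R"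
proof -
  have "Sup {y. (x, y) \<in> R} \<in> {y. (x, y) \<in> R}"
    using compact_section[of x] section_nonempty[OF assms]
    by (intro closed_contains_Sup bounded_imp_bdd_above compact_imp_closed compact_imp_bounded)
  then show ?thesis
    by (simp add: hup_def)
qed

text \<open>An arbitrary nonempty subset is allowed because \<open>x_H\<close> and
  \<open>x_L\<close> fall back to \<open>R\<close> itself when \<open>R_top\<close> or
  \<open>R_bottom\<close> is empty.\<close>

lemma Sup_fst_bounds:
  assumes "S \<subseteq> R" "S \<noteq> {}"
  shows "Sup (fst ` S) \<in> {xmin R..xmax R}" "Inf (fst ` S) \<in> {xmin R..xmax R}"
proof -
  have S: "xmin R \<le> x \<and> x \<le> xmax R" if "x \<in> fst ` S" for x
    using that assms(1) mem_R_bounds by fastforce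
  obtain s where s: "s \<in> fst ` S"
    using assms(2) by blast
  have bdd: "bdd_above (fst ` S)" "bdd_below (fst ` S)"
    using S by (auto intro!: bdd_aboveI[of _ "xmax R"] bdd_belowI[of _ "xmin R"])
  have "Sup (fst ` S) \<le> xmax R"
    using s S by (intro cSup_least) blast+
  moreover have "xmin R \<le> Inf (fst ` S)"
    using s S by (intro cInf_greatest) blast+
  ultimately show "Sup (fst ` S) \<in> {xmin R..xmax R}" "Inf (fst ` S) \<in> {xmin R..xmax R}"
    using S[OF s] cSup_upper[OF s bdd(1)] cInf_lower[OF s bdd(2)]
    unfolding atLeastAtMost_iff by linarith+
qed

lemma x_H_bounds: "x_H m R \<in> {xmin R..xmax R}"
  unfolding x_H_def by (intro Sup_fst_bounds) (auto simp: R_top_def nonempty_R)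

lemma x_L_bounds: "x_L m R \<in> {xmin R..xmax R}"
  unfolding x_L_def by (intro Sup_fst_bounds) (auto simp: R_bottom_def nonempty_R)

lemma xbar_u_bounds: "xbar_u m rl rh R C \<in> {xmin R..xmax R}"
proof (cases "m \<le> x_L m R + y_L m R")
  case True
  then show ?thesis
    using x_L_bounds by (simp add: xbar_u_def)
next
  case False
  let ?S = "{x \<in> {x_L m R..xmax R}. xmin R < x \<and>
           (\<exists>D. has_left_deriv (hlow_cap m R) x D \<and>
                ereal ((1 - C) * (rh / rl)) * D - ereal C < 0)}"
  have "bdd_above (insert (x_L m R) ?S)"
    by (rule bdd_aboveI[of _ "xmax R"]) (use x_L_bounds in auto)
  then have "x_L m R \<le> Sup (insert (x_L m R) ?S)"
    by (intro cSup_upper) auto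
  moreover have "Sup (insert (x_L m R) ?S) \<le> xmax R"
    using x_L_bounds by (intro cSup_least) auto
  ultimately show ?thesis
    using False x_L_bounds by (simp add: xbar_u_def)
qed

lemma xund_u_ge:
  "x \<in> {xmin R<..<xbar_u m rl rh R C} \<Longrightarrow> C \<le> CP_o m rl rh m (x, hlow R x) \<Longrightarrow>
    x \<le> xund_u m rl rh R C"
  unfolding xund_u_def
  by (intro cSup_upper bdd_aboveI[of _ "max (xmin R) (xbar_u m rl rh R C)"]) auto

lemma xmin_le_xund_u: "xmin R \<le> xund_u m rl rh R C"
  unfolding xund_u_def
  by (intro cSup_upper bdd_aboveI[of _ "max (xmin R) (xbar_u m rl rh R C)"]) auto

lemma xbar_l_le:
  "x \<in> {x_H m R<..<xmax R} \<Longrightarrow> C \<le> CP_u m rl rh 0 (x, hup R x) \<Longrightarrow>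
    xbar_l m rl rh R C \<le> x"
  unfolding xbar_l_def
  by (intro cInf_lower bdd_belowI[of _ "min (x_H m R) (xmax R)"]) auto

lemma xbar_l_le_xmax: "xbar_l m rl rh R C \<le> xmax R"
  unfolding xbar_l_def
  by (intro cInf_lower bdd_belowI[of _ "min (x_H m R) (xmax R)"]) auto

lemma x_minus_one_bounds: "x_minus_one m rl rh R C \<in> {x_H m R..xmax R}"
proof (cases "\<forall>x\<in>{x_H m R..xmax R}. \<forall>D. has_left_deriv (l_bound m rl rh R C) x D \<longrightarrow> -1 \<le> D")
  case True
  then show ?thesis
    using x_H_bounds unfolding x_minus_one_def by simp
next
  case False
  let ?S = "{x \<in> {x_H m R..xmax R}. \<exists>D. has_left_deriv (l_bound m rl rh R C) x D \<and> D \<le> -1}"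
  obtain s where s: "s \<in> ?S"
    using False by (force simp: not_le)
  have "bdd_above ?S"
    by (rule bdd_aboveI[of _ "xmax R"]) auto
  then have "s \<le> Sup ?S"
    using s by (intro cSup_upper)
  moreover have "Sup ?S \<le> xmax R"
    using s by (intro cSup_least) auto
  ultimately show ?thesis
    using s False unfolding x_minus_one_def by (simp only: if_False) auto
qed

section \<open>One-sided limits along the boundary curves, and protection levels between the two
  bounds\<close>

lemma interval_limit_in_R:
  assumes "a < b" "closed S" "\<And>x. a < x \<Longrightarrow> x < b \<Longrightarrow> \<exists>y. (x, y) \<in> R \<inter> S" "z \<in> {a..b}"
  shows "\<exists>y. (z, y) \<in> R \<inter> S"
proof -
  \<comment> \<open>Projecting the compact set \<open>R \<inter> S\<close> replaces any continuity
    of \<open>hlow\<close> or \<open>hup\<close>: a closed condition met in every section over an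
    open interval is met in some point of the sections over its end points.\<close>
  have "compact (fst ` (R \<inter> S))"
    by (intro compact_continuous_image continuous_intros compact_Int_closed compact_R assms)
  moreover have "{a<..<b} \<subseteq> fst ` (R \<inter> S)"
    using assms(3) by force
  ultimately have "closure {a<..<b} \<subseteq> fst ` (R \<inter> S)"
    by (intro closure_minimal compact_imp_closed)
  then have "z \<in> fst ` (R \<inter> S)"
    using assms by auto
  then show ?thesis
    by force
qed

text \<open>If the ratio were below \<open>C\<close> on the lower boundary everywhere just left of
  \<open>z\<close>, the reverse inequality would pass to a limit point over \<open>z\<close> and
  from there down to \<open>hlow R z\<close>.\<close>

lemma CP_o_hlow_left_approx:
  assumes C: "0 \<le> C" "C \<le> 1" and z: "xmin R < z" "z \<le> xmax R" and "a < z"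
    and gt: "C < CP_o m rl rh m (z, hlow R z)"
  shows "\<exists>x. a < x \<and> xmin R < x \<and> x < z \<and> C \<le> CP_o m rl rh m (x, hlow R x)"
proof (rule ccontr)
  assume contra: "\<not> ?thesis"
  let ?a = "max a (xmin R)"
  \<comment> \<open>With protection \<open>m\<close> the numerator of \<open>CP_o\<close> is only
    \<open>min y m * rh\<close>. \<open>S\<close> is the condition that the ratio is at most
    \<open>C\<close>, cleared of its denominator and hence closed.\<close>
  define S where "S = {q. min (snd q) m * rh \<le> C * opt m rl rh q}"
  have "closed S"
    unfolding S_def opt_def case_prod_beta by (intro closed_Collect_le continuous_intros)
  moreover have "(x, hlow R x) \<in> R \<inter> S" if x: "?a < x" "x < z" for x
  proof -
    have "(x, hlow R x) \<in> R"
      using x z by (intro hlow_mem) auto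
    moreover have "\<not> C \<le> CP_o m rl rh m (x, hlow R x)"
      using contra x by auto
    ultimately show ?thesis
      using nonneg_R[of x "hlow R x"] C m_pos by (auto simp: le_CP_o_iff S_def)
  qed
  ultimately obtain y where y: "(z, y) \<in> R" "(z, y) \<in> S"
    using interval_limit_in_R[of ?a z S z] z \<open>a < z\<close> by fastforce
  let ?h = "hlow R z"
  have h: "(z, ?h) \<in> R" "?h \<le> y"
    using hlow_mem[of z] z section_bounds[OF y(1)] by auto
  then have pos: "0 < opt m rl rh (z, ?h)"
    using opt_pos nonneg_R[OF h(1)] xmin_nonneg z by auto
  have z0: "0 \<le> z" "0 \<le> ?h"
    using nonneg_R[OF h(1)] by auto
  then have "C * opt m rl rh (z, ?h) < min ?h m * rh"
    using gt pos m_pos by (simp add: CP_o_def ratio_def pos_less_divide_eq split: if_splits)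
  moreover have "min y m * rh \<le> C * opt m rl rh (z, y)"
    using y(2) by (simp add: S_def)
  \<comment> \<open>The limit point is only known to lie above \<open>?h\<close>. Lowering
    \<open>y\<close> raises the low part of the optimum and lowers
    \<open>(1 - C) * (min y m * rh)\<close>, so the inequality of \<open>S\<close> descends from
    \<open>y\<close> to \<open>?h\<close>.\<close>
  moreover have "C * (min z (max 0 (m - y)) * rl) \<le> C * (min z (max 0 (m - ?h)) * rl)"
    using h C rl_pos by (intro mult_left_mono mult_right_mono) auto
  moreover have "(1 - C) * (min ?h m * rh) \<le> (1 - C) * (min y m * rh)"
    using h C rh_pos by (intro mult_left_mono mult_right_mono) auto
  ultimately show False
    by (simp add: opt_def algebra_simps)
qed

text \<open>The same limit argument on the upper boundary. Here the reverse inequality has to be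
  carried from the limit point up to \<open>hup R z\<close>.\<close>

lemma CP_u_hup_right_approx:
  assumes C: "0 \<le> C" "C \<le> 1" and z: "xmin R \<le> z" "z < xmax R" and "z < b"
    and gt: "C < CP_u m rl rh 0 (z, hup R z)"
  shows "\<exists>x. z < x \<and> x < b \<and> x < xmax R \<and> C \<le> CP_u m rl rh 0 (x, hup R x)"
proof (rule ccontr)
  assume contra: "\<not> ?thesis"
  let ?b = "min b (xmax R)"
  let ?N = "\<lambda>x y. min y (max 0 (m - x)) * rh + min x m * rl"
  \<comment> \<open>\<open>?N\<close> is the numerator of \<open>CP_u\<close> at
    \<open>p = 0\<close>. Where \<open>m \<le> x + y\<close> it does not depend on \<open>y\<close>,
    while the optimum grows with \<open>y\<close>; this lets the inequality move upwards.\<close>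
  define S where "S = {q. ?N (fst q) (snd q) \<le> C * opt m rl rh q} \<inter> {q. m \<le> fst q + snd q}"
  have "closed S"
    unfolding S_def opt_def case_prod_beta
    by (intro closed_Int closed_Collect_le continuous_intros)
  moreover have "(x, hup R x) \<in> R \<inter> S" if x: "z < x" "x < ?b" for x
  proof -
    let ?h = "hup R x"
    have R: "(x, ?h) \<in> R"
      using x z by (intro hup_mem) auto
    then have nn: "0 \<le> x" "0 \<le> ?h"
      using nonneg_R by auto
    have "\<not> C \<le> CP_u m rl rh 0 (x, ?h)"
      using contra x by auto
    then have less: "?N x ?h < C * opt m rl rh (x, ?h)"
      using nn C m_pos by (simp add: le_CP_u_iff)
    also have "\<dots> \<le> opt m rl rh (x, ?h)"
      using opt_nonneg[OF nn] C by (simp add: mult_left_le_one_le)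
    \<comment> \<open>Otherwise all demand fits, and \<open>?N\<close> would equal the
      optimum.\<close>
    finally have "m \<le> x + ?h"
      using nn by (cases "m \<le> x + ?h") (auto simp: opt_def min_def max_def split: if_splits)
    then show ?thesis
      using R less by (simp add: S_def)
  qed
  ultimately obtain y where y: "(z, y) \<in> R" "(z, y) \<in> S"
    using interval_limit_in_R[of z ?b S z] z \<open>z < b\<close> by fastforce
  let ?h = "hup R z"
  have h: "(z, ?h) \<in> R" "y \<le> ?h"
    using hup_mem[of z] z section_bounds[OF y(1)] by auto
  have nn: "0 \<le> z" "0 \<le> y"
    using nonneg_R[OF y(1)] by auto
  have S: "?N z y \<le> C * opt m rl rh (z, y)" "m \<le> z + y"
    using y(2) by (auto simp: S_def)
  have "C * opt m rl rh (z, y) \<le> C * opt m rl rh (z, ?h)"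
    using opt_mono_high[OF nn h(2)] C by (simp add: mult_left_mono)
  moreover have "?N z ?h = ?N z y"
    using S(2) h(2) nn by (auto simp: min_def max_def)
  moreover have "\<not> ?N z ?h \<le> C * opt m rl rh (z, ?h)"
  proof (cases "opt m rl rh (z, ?h) = 0")
    \<comment> \<open>The ratio has its default value 1 here, so \<open>gt\<close> says nothing
      about numerator and optimum. But a zero optimum means zero demand, contrary to
      \<open>m \<le> z + y\<close>.\<close>
    case True
    then have "z = 0"
      using opt_pos[of z ?h] nn h by (cases "0 < z") auto
    moreover have "0 < min ?h m * rh" if "0 < ?h"
      using that m_pos rh_pos by simp
    ultimately have "?h = 0"
      using True nn h m_pos by (force simp: opt_def)
    with \<open>z = 0\<close> show ?thesis
      using S(2) h(2) m_pos by auto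
  next
    case False
    then have "0 < opt m rl rh (z, ?h)"
      using opt_nonneg[of z ?h] nn h by auto
    then show ?thesis
      using gt nn h(2) by (simp add: CP_u_def ratio_def pos_less_divide_eq max_def split: if_splits)
  qed
  ultimately show False
    using S by linarith
qed

text \<open>As \<open>p\<close> is nonincreasing, it suffices to bound it at \<open>z\<close>, where
  \<open>u_bound\<close> is evaluated. Unless the bound is \<open>m\<close>, the ratio is at least
  \<open>C\<close> at \<open>p z\<close> and at most \<open>C\<close> at \<open>m\<close>, so the
  intermediate value theorem gives a solution of the defining equation above
  \<open>p z\<close>.\<close>

lemma le_u_bound:
  assumes C: "0 \<le> C" "C \<le> 1"
    and p: "antimono_on {xmin R..xmax R} p" "\<And>x. x \<in> {xmin R..xmax R} \<Longrightarrow> p x \<in> {0..m}"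
    and CP: "\<And>x. x \<in> {xmin R..xmax R} \<Longrightarrow> C \<le> CP_o m rl rh (p x) (x, hlow R x)"
    and x: "x \<in> {xmin R..xmax R}"
  shows "p x \<le> u_bound m rl rh R C x"
proof -
  define z where "z = min x (xbar_u m rl rh R C)"
  have z: "z \<in> {xmin R..xmax R}"
    using x xbar_u_bounds[of C] by (auto simp: z_def)
  let ?P = "CP_o m rl rh m (z, hlow R z)"
  let ?E = "{p \<in> {0..m}. CP_o m rl rh p (z, hlow R z) = C}"
  have "p x \<le> p z"
    using p(1) x z by (auto simp: monotone_on_def z_def)
  also have "p z \<le> u_bound m rl rh R C x"
  proof (cases "z < xund_u m rl rh R C \<or> z = xund_u m rl rh R C \<and> C \<le> ?P")
    case True
    then show ?thesis
      using p(2)[OF z] unfolding u_bound_def Let_def z_def[symmetric] by simp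
  next
    case False
    \<comment> \<open>If full protection had a ratio above \<open>C\<close> at \<open>z\<close>, it
      would still have ratio at least \<open>C\<close> at some point strictly between
      \<open>xund_u\<close> and \<open>z\<close>, against the choice of \<open>xund_u\<close> as a
      supremum.\<close>
    have "?P \<le> C"
    proof (rule ccontr)
      assume "\<not> ?P \<le> C"
      then have *: "C < ?P" "xund_u m rl rh R C < z"
        using False by auto
      then obtain x' where "xund_u m rl rh R C < x'" "xmin R < x'" "x' < z"
          "C \<le> CP_o m rl rh m (x', hlow R x')"
        using CP_o_hlow_left_approx[OF C, of z "xund_u m rl rh R C"] xmin_le_xund_u[of C] z
        by fastforce
      then show False
        using xund_u_ge[of x' C] by (auto simp: z_def)
    qed
    then have "\<exists>p'. p z \<le> p' \<and> p' \<le> m \<and> CP_o m rl rh p' (z, hlow R z) = C"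
      using CP[OF z] p(2)[OF z] by (intro IVT2' continuous_on_CP_o) auto
    then obtain p' where p': "p z \<le> p'" "p' \<in> ?E"
      using p(2)[OF z] by auto
    have "p' \<le> Sup (insert 0 ?E)"
      by (intro cSup_upper bdd_aboveI[of _ m]) (use p' m_pos in auto)
    moreover have "u_bound m rl rh R C x = Sup (insert 0 ?E)"
      unfolding u_bound_def Let_def z_def[symmetric] by (rule if_not_P[OF False])
    ultimately show ?thesis
      using p'(1) by simp
  qed
  finally show ?thesis .
qed

text \<open>The mirror image: \<open>z\<close> lies to the right of \<open>x\<close>, and the
  intermediate value theorem on \<open>{0..p z}\<close> gives a solution below
  \<open>p z\<close>.\<close>

lemma l_bound_le:
  assumes C: "0 \<le> C" "C \<le> 1"
    and p: "antimono_on {xmin R..xmax R} p" "\<And>x. x \<in> {xmin R..xmax R} \<Longrightarrow> p x \<in> {0..m}"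
    and CP: "\<And>x. x \<in> {xmin R..xmax R} \<Longrightarrow> C \<le> CP_u m rl rh (p x) (x, hup R x)"
    and x: "x \<in> {xmin R..xmax R}"
  shows "l_bound m rl rh R C x \<le> p x"
proof -
  define z where "z = max x (x_H m R)"
  have z: "z \<in> {xmin R..xmax R}" "x_H m R \<le> z"
    using x x_H_bounds by (auto simp: z_def)
  let ?P = "CP_u m rl rh 0 (z, hup R z)"
  let ?E = "{p \<in> {0..m}. CP_u m rl rh p (z, hup R z) = C}"
  have "l_bound m rl rh R C x \<le> p z"
  proof (cases "xbar_l m rl rh R C < z \<or> z = xbar_l m rl rh R C \<and> C \<le> ?P")
    case True
    then show ?thesis
      using p(2)[OF z(1)] unfolding l_bound_def Let_def z_def[symmetric] by simp
  next
    case False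
    have "?P \<le> C"
    proof (rule ccontr)
      assume "\<not> ?P \<le> C"
      then have *: "C < ?P" "z < xbar_l m rl rh R C"
        using False by auto
      then obtain x' where "z < x'" "x' < xbar_l m rl rh R C" "x' < xmax R"
          "C \<le> CP_u m rl rh 0 (x', hup R x')"
        using CP_u_hup_right_approx[OF C, of z "xbar_l m rl rh R C"] xbar_l_le_xmax[of C] z
        by fastforce
      then show False
        using xbar_l_le[of x' C] z by auto
    qed
    then have "\<exists>p'. 0 \<le> p' \<and> p' \<le> p z \<and> CP_u m rl rh p' (z, hup R z) = C"
      using CP[OF z(1)] p(2)[OF z(1)] by (intro IVT' continuous_on_CP_u) auto
    then obtain p' where p': "p' \<le> p z" "p' \<in> ?E"
      using p(2)[OF z(1)] by auto
    have "Inf (insert m ?E) \<le> p'"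
      by (intro cInf_lower bdd_belowI[of _ 0]) (use p' m_pos in auto)
    moreover have "l_bound m rl rh R C x = Inf (insert m ?E)"
      unfolding l_bound_def Let_def z_def[symmetric] by (rule if_not_P[OF False])
    ultimately show ?thesis
      using p'(1) by simp
  qed
  also have "p z \<le> p x"
    using p(1) x z by (auto simp: monotone_on_def z_def)
  finally show ?thesis .
qed

text \<open>Beyond \<open>x_minus_one\<close> the bound descends with slope -1 until it reaches 0,
  whereas \<open>p\<close> descends no faster and stays nonnegative.\<close>

lemma l_tilde_le:
  assumes l: "\<And>x. x \<in> {xmin R..xmax R} \<Longrightarrow> l_bound m rl rh R C x \<le> p x"
    and p: "\<And>x. x \<in> {xmin R..xmax R} \<Longrightarrow> 0 \<le> p x"
      "\<And>x y. xmin R \<le> x \<Longrightarrow> x \<le> y \<Longrightarrow> y \<le> xmax R \<Longrightarrow> p x - (y - x) \<le> p y"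
    and x: "x \<in> {xmin R..xmax R}"
  shows "l_tilde m rl rh R C x \<le> p x"
proof -
  let ?x1 = "x_minus_one m rl rh R C"
  have x1: "?x1 \<in> {xmin R..xmax R}"
    using x_minus_one_bounds[of C] x_H_bounds by auto
  show ?thesis
    using l[OF x] l[OF x1] p(1)[OF x] p(2)[of ?x1 x] x x1
    by (auto simp: l_tilde_def Let_def)
qed

text \<open>This bounds the set under the supremum in \<open>C_star\<close>. For larger
  \<open>C\<close> neither defining equation has a solution at \<open>x_H\<close>, so the inserted
  end points make the upper bound 0 and the lower bound \<open>m\<close> there.\<close>

lemma feasible_imp_le:
  assumes "feasible m rl rh R C p"
  shows "C \<le> max 2 (m * (rh + rl) / opt m rl rh (x_H m R, hup R (x_H m R)))"
proof (rule ccontr)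
  let ?x = "x_H m R"
  assume "\<not> ?thesis"
  then have C: "2 < C" "m * (rh + rl) / opt m rl rh (?x, hup R ?x) < C"
    by auto
  have nn: "0 \<le> ?x" "0 \<le> hup R ?x"
    using nonneg_R[OF hup_mem[OF x_H_bounds]] by auto
  have CP_u: "CP_u m rl rh p (?x, hup R ?x) < C" if "p \<in> {0..m}" for p
    using CP_u_le[OF nn, of p] that C by auto
  have CP_o: "CP_o m rl rh p (x, hlow R x) < C" if "p \<in> {0..m}" "x \<in> {xmin R..xmax R}" for p x
    using CP_o_le_2[of x "hlow R x" p] nonneg_R[OF hlow_mem[OF that(2)]] that(1) C by auto
  have "xund_u m rl rh R C = xmin R"
  proof -
    have empty: "{x \<in> {xmin R<..<xbar_u m rl rh R C}. C \<le> CP_o m rl rh m (x, hlow R x)} = {}"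
      using xbar_u_bounds[of C] CP_o[of m] m_pos by (auto simp: not_le)
    then show ?thesis
      by (simp only: xund_u_def empty cSup_singleton)
  qed
  define z where "z = min ?x (xbar_u m rl rh R C)"
  have z: "z \<in> {xmin R..xmax R}"
    using x_H_bounds xbar_u_bounds[of C] by (auto simp: z_def)
  have "{p \<in> {0..m}. CP_o m rl rh p (z, hlow R z) = C} = {}"
    using CP_o[OF _ z] by force
  moreover have "\<not> (z < xund_u m rl rh R C \<or>
      z = xund_u m rl rh R C \<and> C \<le> CP_o m rl rh m (z, hlow R z))"
    using CP_o[OF _ z, of m] m_pos z \<open>xund_u m rl rh R C = xmin R\<close> by auto
  ultimately have u: "u_bound m rl rh R C ?x = 0"
    unfolding u_bound_def Let_def z_def[symmetric] by (simp only: if_False cSup_singleton)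
  have "?x \<le> xbar_l m rl rh R C"
    unfolding xbar_l_def using x_H_bounds by (intro cInf_greatest) auto
  moreover have "{p \<in> {0..m}. CP_u m rl rh p (?x, hup R ?x) = C} = {}"
    using CP_u by force
  moreover have "\<not> (xbar_l m rl rh R C < ?x \<or>
      ?x = xbar_l m rl rh R C \<and> C \<le> CP_u m rl rh 0 (?x, hup R ?x))"
    using CP_u[of 0] m_pos \<open>?x \<le> xbar_l m rl rh R C\<close> by auto
  ultimately have "l_bound m rl rh R C ?x = m"
    unfolding l_bound_def Let_def max.idem by (simp only: if_False cInf_singleton)
  then have "l_tilde m rl rh R C ?x = m"
    using x_minus_one_bounds[of C] by (auto simp: l_tilde_def Let_def)
  then show False
    using assms u x_H_bounds m_pos unfolding feasible_def by fastforce
qed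

lemma feasible_le_C_star: "feasible m rl rh R C p \<Longrightarrow> C \<le> C_star m rl rh R"
  unfolding C_star_def using feasible_imp_le by (intro cSup_upper bdd_aboveI) blast+

end


section \<open>Differentiable allocation functions\<close>

text \<open>Averaging \<open>q (x * t)\<close> over \<open>t\<close> in \<open>{1 - e..1}\<close>
  keeps monotonicity and the Lipschitz constant. Dilations, unlike translations, fix 0, so the error
  is proportional to \<open>x\<close>.\<close>

lemma differentiable_average:
  fixes q :: "real \<Rightarrow> real"
  assumes mono: "\<And>x y. x \<le> y \<Longrightarrow> q x \<le> q y"
    and lip: "\<And>x y. x \<le> y \<Longrightarrow> q y \<le> q x + (y - x)"
    and e: "0 < e" "e < 1"
  obtains q' :: "real \<Rightarrow> real" where
    "\<And>x y. x \<le> y \<Longrightarrow> q' x \<le> q' y" "\<And>x y. x \<le> y \<Longrightarrow> q' y \<le> q' x + (y - x)"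
    "\<And>x. 0 \<le> x \<Longrightarrow> q x - e * x \<le> q' x" "\<And>x. 0 \<le> x \<Longrightarrow> q' x \<le> q x"
    "\<And>x. 0 < x \<Longrightarrow> q' differentiable (at x)"
proof -
  have "1-lipschitz_on UNIV q"
  proof (rule lipschitz_onI)
    show "dist (q x) (q y) \<le> 1 * dist x y" for x y
      using mono[of x y] lip[of x y] mono[of y x] lip[of y x] by (auto simp: dist_real_def abs_if)
  qed simp
  then have cont: "continuous_on S q" for S
    using lipschitz_on_continuous_on continuous_on_subset by blast
  define I where "I x = integral {1 - e..1} (\<lambda>t. q (x * t))" for x
  have int: "(\<lambda>t. q (x * t)) integrable_on {1 - e..1}" for x
    by (intro integrable_continuous_real continuous_on_compose2[OF cont[of UNIV]] continuous_intros) auto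
  have const: "integral {1 - e..1} (\<lambda>t. c) = e * c" for c
    using e by simp
  define q' where "q' x = I x / e" for x
  show ?thesis
  proof (rule that)
    fix x y :: real assume xy: "x \<le> y"
    have "I x \<le> I y"
      unfolding I_def using xy e by (intro integral_le int mono mult_right_mono) auto
    then show "q' x \<le> q' y"
      using e by (simp add: q'_def divide_right_mono)
    have "I y \<le> integral {1 - e..1} (\<lambda>t. q (x * t) + (y - x))"
      unfolding I_def
    proof (intro integral_le int integrable_add integrable_const_ivl)
      fix t assume t: "t \<in> {1 - e..1}"
      have "x * t \<le> y * t"
        using xy e t by (intro mult_right_mono) auto
      moreover have "(y - x) * t \<le> (y - x) * 1"
        using xy t by (intro mult_left_mono) auto
      ultimately show "q (y * t) \<le> q (x * t) + (y - x)"
        using lip[of "x * t" "y * t"] by (simp add: algebra_simps)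
    qed
    also have "\<dots> = I x + e * (y - x)"
      unfolding I_def const[symmetric] by (intro integral_add int integrable_const_ivl)
    finally show "q' y \<le> q' x + (y - x)"
      using e by (simp add: q'_def field_simps)
  next
    fix x :: real assume x: "0 \<le> x"
    have "integral {1 - e..1} (\<lambda>t. q x - e * x) \<le> I x"
      unfolding I_def
    proof (intro integral_le int integrable_const_ivl)
      fix t assume t: "t \<in> {1 - e..1}"
      have "x * t \<le> x" "x * (1 - e) \<le> x * t"
        using x t by (auto intro: mult_left_mono mult_left_le)
      then show "q x - e * x \<le> q (x * t)"
        using lip[of "x * t" x] by (simp add: algebra_simps)
    qed
    then show "q x - e * x \<le> q' x"
      using e by (simp add: const q'_def field_simps)
    have "I x \<le> integral {1 - e..1} (\<lambda>t. q x)"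
      unfolding I_def using x by (intro integral_le int integrable_const_ivl mono mult_left_le) auto
    then show "q' x \<le> q x"
      using e by (simp add: const q'_def field_simps)
  next
    fix x :: real assume x: "0 < x"
    define F where "F u = integral {0..u} q" for u
    have F: "(F has_real_derivative q u) (at u)" if "0 < u" for u
    proof -
      have "(F has_real_derivative q u) (at u within {0..u + 1})"
        unfolding F_def using that by (intro integral_has_real_derivative cont) auto
      moreover have "at u within {0..u + 1} = at u"
        using that by (intro at_within_interior) simp
      ultimately show ?thesis
        by simp
    qed
    \<comment> \<open>Substituting \<open>v = u * t\<close> turns the average into an integral of
      \<open>q\<close> over \<open>{(1 - e) * u..u}\<close>, which the fundamental theorem of
      calculus differentiates; \<open>e < 1\<close> keeps the lower end positive.\<close>
    have I_eq: "I u = (F u - F ((1 - e) * u)) / u" if u: "0 < u" for u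
    proof -
      have "(\<lambda>t. t / u) ` {(1 - e) * u..u} = {1 - e..1}"
        using image_divide_atLeastAtMost[OF u, of "(1 - e) * u" u] u by simp
      then have "I u = integral {(1 - e) * u..u} q / u"
        using integral_stretch_real[of u "(1 - e) * u" u q] u by (simp add: I_def)
      moreover have "F ((1 - e) * u) + integral {(1 - e) * u..u} q = F u"
        unfolding F_def using e u
        by (intro Henstock_Kurzweil_Integration.integral_combine integrable_continuous_real cont)
          (auto simp: mult_left_le_one_le)
      ultimately show ?thesis
        by simp
    qed
    have "((\<lambda>u. F ((1 - e) * u)) has_real_derivative q ((1 - e) * x) * ((1 - e) * 1)) (at x)"
      using x e by (intro DERIV_chain2[OF F] DERIV_cmult DERIV_ident) auto
    from DERIV_cdivide[OF DERIV_divide[OF DERIV_diff[OF F[OF x] this] DERIV_ident], of e] x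
    obtain D where "((\<lambda>u. (F u - F ((1 - e) * u)) / u / e) has_real_derivative D) (at x)"
      by blast
    then have "(q' has_real_derivative D) (at x)"
      by (rule has_field_derivative_transform_within_open[of _ _ _ "{0<..}"])
        (use x in \<open>auto simp: q'_def I_eq\<close>)
    then show "q' differentiable (at x)"
      using real_differentiable_def by blast
  qed
qed

section \<open>Feasible protection levels from allocation functions\<close>

context ml_region
begin

text \<open>The reward inequality is used only at \<open>hlow R x\<close>, for the upper bound, and
  at \<open>hup R x\<close>, for the lower bound.\<close>

lemma feasible_of_differentiable:
  assumes C: "0 \<le> C" "C \<le> 1"
    and mono: "\<And>x y. 0 \<le> x \<Longrightarrow> x \<le> y \<Longrightarrow> q x \<le> q y"
    and lip: "\<And>x y. 0 \<le> x \<Longrightarrow> x \<le> y \<Longrightarrow> q y \<le> q x + (y - x)"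
    and bounds: "\<And>x. 0 \<le> x \<Longrightarrow> 0 \<le> q x \<and> q x \<le> x \<and> q x \<le> m"
    and diff: "\<And>x. 0 < x \<Longrightarrow> q differentiable (at x)"
    and reward: "\<And>x y. (x, y) \<in> R \<Longrightarrow> C * opt m rl rh (x, y) \<le> low_first_reward m rl rh (q x) y"
  shows "feasible m rl rh R C (\<lambda>x. m - q x)"
proof -
  have nonneg: "0 \<le> x" if "x \<in> {xmin R..xmax R}" for x
    using that xmin_nonneg by auto
  have antimono: "antimono_on {xmin R..xmax R} (\<lambda>x. m - q x)"
    using mono nonneg by (auto simp: monotone_on_def)
  have range: "m - q x \<in> {0..m}" if "x \<in> {xmin R..xmax R}" for x
    using bounds[OF nonneg[OF that]] by auto
  have CP_o: "C \<le> CP_o m rl rh (m - q x) (x, hlow R x)" if "x \<in> {xmin R..xmax R}" for x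
    using C bounds[OF nonneg[OF that]] nonneg_R[OF hlow_mem[OF that]] reward[OF hlow_mem[OF that]]
    by (intro le_CP_o_low_first) auto
  have CP_u: "C \<le> CP_u m rl rh (m - q x) (x, hup R x)" if "x \<in> {xmin R..xmax R}" for x
    using C bounds[OF nonneg[OF that]] nonneg_R[OF hup_mem[OF that]] reward[OF hup_mem[OF that]]
    by (intro le_CP_u_low_first) auto
  have u: "m - q x \<le> u_bound m rl rh R C x" if "x \<in> {xmin R..xmax R}" for x
    by (rule le_u_bound[OF C antimono range CP_o that])
  have l: "l_bound m rl rh R C x \<le> m - q x" if "x \<in> {xmin R..xmax R}" for x
    by (rule l_bound_le[OF C antimono range CP_u that])
  have l_tilde: "l_tilde m rl rh R C x \<le> m - q x" if x: "x \<in> {xmin R..xmax R}" for x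
  proof (rule l_tilde_le[OF l _ _ x])
    show "0 \<le> m - q x'" if "x' \<in> {xmin R..xmax R}" for x'
      using range[OF that] by simp
    show "m - q x' - (y - x') \<le> m - q y" if "xmin R \<le> x'" "x' \<le> y" "y \<le> xmax R" for x' y
      using lip[of x' y] that xmin_nonneg by simp
  qed
  have Lipschitz: "1-lipschitz_on {0..xmax R} (\<lambda>x. m - q x)"
  proof (rule lipschitz_onI)
    show "dist (m - q x) (m - q y) \<le> 1 * dist x y"
      if "x \<in> {0..xmax R}" "y \<in> {0..xmax R}" for x y
    proof (cases "x \<le> y")
      case True
      then show ?thesis
        using mono[of x y] lip[of x y] that by (auto simp: dist_real_def)
    next
      case False
      then show ?thesis
        using mono[of y x] lip[of y x] that by (auto simp: dist_real_def)
    qed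
  qed simp
  have deriv: "\<exists>D. ((\<lambda>x. m - q x) has_real_derivative D) (at x) \<and> -1 \<le> D \<and> D \<le> 0" if x: "0 < x" for x
  proof -
    obtain D where D: "(q has_real_derivative D) (at x)"
      using diff[OF x] real_differentiable_def by blast
    have "mono_on {0<..} q"
      using mono by (auto simp: monotone_on_def)
    then have "0 \<le> D"
      by (rule mono_on_imp_deriv_nonneg[OF _ D]) (use x in \<open>simp add: interior_open\<close>)
    \<comment> \<open>The Lipschitz bound says that \<open>x - q x\<close> is nondecreasing, which
      gives \<open>D \<le> 1\<close>.\<close>
    have "((\<lambda>x. x - q x) has_real_derivative (1 - D)) (at x)"
      by (intro DERIV_diff DERIV_ident D)
    moreover have "mono_on {0<..} (\<lambda>x. x - q x)"
    proof (rule monotone_onI)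
      show "x - q x \<le> y - q y" if "x \<in> {0<..}" "y \<in> {0<..}" "x \<le> y" for x y
        using lip[of x y] that by simp
    qed
    ultimately have "0 \<le> 1 - D"
      using mono_on_imp_deriv_nonneg[of "{0<..}" "\<lambda>x. x - q x" "1 - D" x] x
      by (simp add: interior_open)
    moreover have "((\<lambda>x. m - q x) has_real_derivative (0 - D)) (at x)"
      by (intro DERIV_diff DERIV_const D)
    ultimately show ?thesis
      using \<open>0 \<le> D\<close> by (intro exI[of _ "0 - D"]) simp
  qed
  \<comment> \<open>Nothing is known about differentiability at 0, a null set.\<close>
  have "AE x in lebesgue. x \<noteq> (0 :: real)"
    by (intro AE_completion AE_lborel_singleton)
  then have "AE x in lebesgue. x \<in> {0..xmax R} \<longrightarrow>
      (\<exists>D. ((\<lambda>x. m - q x) has_real_derivative D) (at x) \<and> -1 \<le> D \<and> D \<le> 0)"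
  proof eventually_elim
    case (elim x)
    then show ?case
      using deriv[of x] by (cases "0 < x") auto
  qed
  moreover have "0 \<le> m - q x" if "x \<in> {0..xmax R}" for x
    using bounds[of x] that by simp
  ultimately show ?thesis
    unfolding feasible_def
    using C u l_tilde Lipschitz lipschitz_on_continuous_on[OF Lipschitz] by blast
qed

lemma C_star_nonneg: "0 \<le> C_star m rl rh R"
proof (rule feasible_le_C_star)
  show "feasible m rl rh R 0 (\<lambda>x. m - (\<lambda>_. 0) x)"
    using m_pos rh_pos nonneg_R
    by (intro feasible_of_differentiable) (auto simp: low_first_reward_def)
qed

text \<open>
  The average over the dilations of \<open>q\<close> by \<open>t \<in> {1 - e..1}\<close> is differentiable and differs from \<open>q x\<close> by
  at most \<open>e * x\<close>. This error is small relative to \<open>opt (x, y)\<close> even near the origin.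
\<close>

lemma le_C_star:
  assumes C: "0 \<le> C" "C \<le> 1"
    and mono: "\<And>x y. x \<le> y \<Longrightarrow> q x \<le> q y"
    and lip: "\<And>x y. x \<le> y \<Longrightarrow> q y \<le> q x + (y - x)"
    and zero: "\<And>x. x \<le> 0 \<Longrightarrow> q x = 0"
    and le_m: "\<And>x. q x \<le> m"
    and reward: "\<And>x y. (x, y) \<in> R \<Longrightarrow> C * opt m rl rh (x, y) \<le> low_first_reward m rl rh (q x) y"
  shows "C \<le> C_star m rl rh R"
proof (cases "C = 0")
  case True
  then show ?thesis
    using C_star_nonneg by simp
next
  case False
  then have "0 < C"
    using C by simp
  then show ?thesis
  \<comment> \<open>Smoothing costs a little of the ratio. Since \<open>C_star\<close> is a
    supremum, it is enough to reach every \<open>C' < C\<close>.\<close>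
  proof (rule dense_le_bounded)
    fix C' assume C': "0 < C'" "C' < C"
    \<comment> \<open>Chosen so that \<open>k * x \<le> min x m\<close> on the region; the summand 1
      keeps the denominator positive when \<open>xmax R = 0\<close>.\<close>
    define k where "k = min 1 (m / (xmax R + 1))"
    have xmax: "0 \<le> xmax R"
      using xmin_nonneg xmin_le_xmax by simp
    then have k: "0 < k" "k \<le> 1"
      using m_pos by (auto simp: k_def)
    \<comment> \<open>With this choice the lost low reward \<open>e * x * rl\<close> is at most
      \<open>(C - C') * opt m rl rh (x, y)\<close>, by \<open>min_le_opt\<close>.\<close>
    define e where "e = (C - C') * k"
    have "e \<le> C - C'"
      using mult_left_mono[of k 1 "C - C'"] C' k by (simp add: e_def)
    then have "e < 1"
      using C C' by linarith
    moreover have "0 < e"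
      using C' k by (simp add: e_def)
    ultimately have e: "0 < e" "e < 1"
      by auto
    obtain q' where mono': "\<And>x y. x \<le> y \<Longrightarrow> q' x \<le> q' y"
      and lip': "\<And>x y. x \<le> y \<Longrightarrow> q' y \<le> q' x + (y - x)"
      and ge: "\<And>x. 0 \<le> x \<Longrightarrow> q x - e * x \<le> q' x" and le: "\<And>x. 0 \<le> x \<Longrightarrow> q' x \<le> q x"
      and diff: "\<And>x. 0 < x \<Longrightarrow> q' differentiable (at x)"
      using differentiable_average[of q e] mono lip e by metis
    have zero': "q' 0 = 0"
      using ge[of 0] le[of 0] zero[of 0] by simp
    have bounds: "0 \<le> q' x \<and> q' x \<le> x \<and> q' x \<le> m" if "0 \<le> x" for x
      using mono'[OF that] lip'[OF that] le[OF that] le_m[of x] zero' by simp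
    have "feasible m rl rh R C' (\<lambda>x. m - q' x)"
    proof (rule feasible_of_differentiable)
      fix x y assume xy: "(x, y) \<in> R"
      have nn: "0 \<le> x" "0 \<le> y"
        using nonneg_R[OF xy] by auto
      have "x \<le> xmax R"
        using mem_R_bounds[OF xy] by simp
      have "k * x \<le> 1 * x"
        using k nn by (intro mult_right_mono) auto
      moreover have "k * x \<le> (m / (xmax R + 1)) * (xmax R + 1)"
        using k nn \<open>x \<le> xmax R\<close> by (intro mult_mono) (auto simp: k_def)
      ultimately have "k * x \<le> min x m"
        using xmax by simp
      then have "k * x * rl \<le> opt m rl rh (x, y)"
        using min_le_opt[OF nn] rl_pos by (smt (verit) mult_right_mono)
      then have "e * x * rl \<le> (C - C') * opt m rl rh (x, y)"
        using C' mult_left_mono[of "k * x * rl" "opt m rl rh (x, y)" "C - C'"]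
        by (simp add: e_def mult.assoc)
      moreover have "(q x - e * x) * rl \<le> q' x * rl"
        using ge[OF nn(1)] rl_pos by (intro mult_right_mono) auto
      moreover have "min y (m - q x) * rh \<le> min y (m - q' x) * rh"
        using le[OF nn(1)] rh_pos by (intro mult_right_mono) auto
      ultimately show "C' * opt m rl rh (x, y) \<le> low_first_reward m rl rh (q' x) y"
        using reward[OF xy] by (simp add: low_first_reward_def algebra_simps)
    qed (use C C' mono' lip' bounds diff in auto)
    then show "C' \<le> C_star m rl rh R"
      by (rule feasible_le_C_star)
  qed
qed

text \<open>Accept low requests up to \<open>C * m\<close>. If high demand exhausts the rest, the
  reward is at least \<open>C * (m * rh)\<close>; otherwise all high demand is served, together with
  at least the fraction \<open>C\<close> of the optimal low units.\<close>

lemma rho_le_C_star: "1 / (2 - rl / rh) \<le> C_star m rl rh R"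
proof -
  define C where "C = 1 / (2 - rl / rh)"
  have r: "0 < rl / rh" "rl / rh < 1"
    using rl_pos rl_less_rh by auto
  then have C: "0 < C" "C < 1"
    by (auto simp: C_def field_simps)
  have "C * (2 - rl / rh) = 1"
    using r by (simp add: C_def)
  \<comment> \<open>This balance defines \<open>C\<close>: it says that \<open>C * m\<close> low and
    \<open>m - C * m\<close> high units together earn exactly \<open>C * (m * rh)\<close>.\<close>
  then have C_eq: "C * (2 * rh - rl) = rh"
    using rh_pos by (simp add: field_simps)
  have Cm: "0 \<le> C * m" "C * m \<le> m"
    using C m_pos by (auto simp: mult_left_le_one_le)
  define q where "q x = max 0 (min x (C * m))" for x
  have "C \<le> C_star m rl rh R"
  proof (rule le_C_star)
    fix x y assume "(x, y) \<in> R"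
    then have nn: "0 \<le> x" "0 \<le> y"
      using nonneg_R by auto
    have q: "q x = min x (C * m)"
      using nn Cm by (simp add: q_def)
    show "C * opt m rl rh (x, y) \<le> low_first_reward m rl rh (q x) y"
    proof (cases "m - q x \<le> y")
      case True
      have "opt m rl rh (x, y) \<le> m * rh"
      proof -
        have "min x (max 0 (m - y)) * rl \<le> (m - min y m) * rh"
          using nn rl_pos rl_less_rh by (intro mult_mono) auto
        then show ?thesis
          by (simp add: opt_def algebra_simps)
      qed
      then have "C * opt m rl rh (x, y) \<le> C * (m * rh)"
        using C by (intro mult_left_mono) auto
      also have "\<dots> = m * rh - C * m * (rh - rl)"
        using arg_cong[OF C_eq, of "\<lambda>v. m * v"] by (simp add: algebra_simps)
      also have "\<dots> \<le> m * rh - q x * (rh - rl)"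
        using q rl_less_rh by (simp add: mult_right_mono)
      also have "\<dots> = low_first_reward m rl rh (q x) y"
        using True by (simp add: low_first_reward_def algebra_simps)
      finally show ?thesis .
    next
      case False
      have "C * (y * rh) \<le> y * rh"
        using C nn rh_pos by (simp add: mult_left_le_one_le)
      moreover have "C * (min x (m - y) * rl) \<le> q x * rl"
      proof -
        have "C * min x (m - y) \<le> C * x" "C * min x (m - y) \<le> C * m" "C * x \<le> x"
          using C nn by (auto intro!: mult_left_mono mult_left_le_one_le)
        then have "C * min x (m - y) \<le> q x"
          unfolding q by simp
        then show ?thesis
          using rl_pos mult_right_mono[of _ _ rl] by (simp add: mult.assoc[symmetric])
      qed
      ultimately show ?thesis
        using False nn Cm q
        by (simp add: opt_def low_first_reward_def min_absorb1 max_absorb2 distrib_left)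
    qed
  qed (use C Cm in \<open>auto simp: q_def\<close>)
  then show ?thesis
    by (simp add: C_def)
qed

end


section \<open>Allocation functions of online algorithms\<close>

lemma nat_floor_diff_le:
  fixes u v :: real
  assumes "u \<le> v"
  shows "real (nat \<lfloor>v\<rfloor>) - real (nat \<lfloor>u\<rfloor>) \<le> v - u + 1"
  using assms by linarith

text \<open>\<open>a n k\<close> is the amount allocated after \<open>k\<close> low requests of size
  \<open>1 / real (Suc n)\<close>. A pointwise limsup is enough: the subsequence may depend on
  \<open>x\<close>, because the reward inequality is later checked at one point at a time.\<close>

lemma lipschitz_limit_of_discretizations:
  fixes a :: "nat \<Rightarrow> nat \<Rightarrow> real"
  assumes zero: "\<And>n. a n 0 = 0"
    and mono: "\<And>n k. a n k \<le> a n (Suc k)"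
    and step: "\<And>n k. a n (Suc k) \<le> a n k + 1 / real (Suc n)"
    and le: "\<And>n k. a n k \<le> m"
  obtains q :: "real \<Rightarrow> real" where
    "\<And>x y. x \<le> y \<Longrightarrow> q x \<le> q y" "\<And>x y. x \<le> y \<Longrightarrow> q y \<le> q x + (y - x)"
    "\<And>x. x \<le> 0 \<Longrightarrow> q x = 0" "\<And>x. q x \<le> m"
    "\<And>x. \<exists>r. strict_mono r \<and> (\<lambda>j. a (r j) (nat \<lfloor>x * real (Suc (r j))\<rfloor>)) \<longlonglongrightarrow> q x"
proof -
  define f where "f n x = a n (nat \<lfloor>x * real (Suc n)\<rfloor>)" for n x
  have nonneg: "0 \<le> a n k" for n k
    using lift_Suc_mono_le[of "a n" 0 k] mono zero by simp
  have f_mono: "f n x \<le> f n y" if "x \<le> y" for n x y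
  proof -
    have "x * real (Suc n) \<le> y * real (Suc n)"
      using that by (intro mult_right_mono) auto
    then show ?thesis
      unfolding f_def by (rule lift_Suc_mono_le[of "a n", OF mono nat_mono[OF floor_mono]])
  qed
  have shift: "a n (k + d) \<le> a n k + real d / real (Suc n)" for n k d
  proof (induction d)
    case (Suc d)
    then show ?case
      using step[of n "k + d"] by (simp add: add_divide_distrib)
  qed simp
  have f_lip: "f n y \<le> f n x + ((y - x) + 1 / real (Suc n))" if "x \<le> y" for n x y
  proof -
    let ?k = "\<lambda>x. nat \<lfloor>x * real (Suc n)\<rfloor>"
    have xy: "x * real (Suc n) \<le> y * real (Suc n)"
      using that by (intro mult_right_mono) auto
    then have "?k x \<le> ?k y"
      by (intro nat_mono floor_mono)
    then have "f n y \<le> f n x + (real (?k y) - real (?k x)) / real (Suc n)"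
      using shift[of n "?k x" "?k y - ?k x"] by (simp add: f_def of_nat_diff)
    also have "(real (?k y) - real (?k x)) / real (Suc n)
        \<le> (y * real (Suc n) - x * real (Suc n) + 1) / real (Suc n)"
      using nat_floor_diff_le[OF xy] by (intro divide_right_mono) auto
    also have "\<dots> = (y - x) + 1 / real (Suc n)"
      by (simp add: field_simps)
    finally show ?thesis
      by simp
  qed
  define q where "q x = real_of_ereal (limsup (\<lambda>n. ereal (f n x)))" for x
  have limsup: "limsup (\<lambda>n. ereal (f n x)) = ereal (q x)" for x
  proof -
    have "limsup (\<lambda>n. ereal 0) \<le> limsup (\<lambda>n. ereal (f n x))"
      by (intro Limsup_mono always_eventually) (simp add: f_def nonneg)
    moreover have "limsup (\<lambda>n. ereal (f n x)) \<le> ereal m"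
      by (intro Limsup_bounded always_eventually) (simp add: f_def le)
    ultimately have "\<bar>limsup (\<lambda>n. ereal (f n x))\<bar> \<noteq> \<infinity>"
      by (auto simp: Limsup_const)
    then show ?thesis
      by (simp add: q_def ereal_real')
  qed
  have subseq: "\<exists>r. strict_mono r \<and> (\<lambda>j. f (r j) x) \<longlonglongrightarrow> q x" for x
    using limsup_subseq_lim[of "\<lambda>n. ereal (f n x)"] by (auto simp: limsup o_def)
  \<comment> \<open>Inequalities pass to the limsup by following a subsequence that attains it at
    \<open>x\<close>, along which the values at \<open>y\<close> are eventually below
    \<open>q y + e\<close>.\<close>
  have q_le: "q x \<le> q y + c" if "\<forall>\<^sub>F n in sequentially. f n x \<le> f n y + c" for x y c
  proof (rule field_le_epsilon)
    fix e :: real assume "0 < e"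
    obtain r where r: "strict_mono r" "(\<lambda>j. f (r j) x) \<longlonglongrightarrow> q x"
      using subseq by blast
    have "\<forall>\<^sub>F n in sequentially. ereal (f n y) < ereal (q y + e)"
      using \<open>0 < e\<close> by (intro Limsup_lessD) (simp add: limsup)
    with that have "\<forall>\<^sub>F n in sequentially. f n x \<le> q y + c + e"
      by eventually_elim simp
    then have "\<forall>\<^sub>F j in sequentially. f (r j) x \<le> q y + c + e"
      by (rule eventually_subseq[OF r(1)])
    then show "q x \<le> q y + c + e"
      using tendsto_upperbound[OF r(2)] by simp
  qed
  show ?thesis
  proof (rule that)
    show "q x \<le> q y" if "x \<le> y" for x y
      using q_le[of x y 0] f_mono[OF that] by simp
    show "q y \<le> q x + (y - x)" if "x \<le> y" for x y
    proof (rule field_le_epsilon)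
      \<comment> \<open>Rounding down adds at most one step \<open>1 / real (Suc n)\<close>, which
        disappears in the limit.\<close>
      fix e :: real assume "0 < e"
      have "\<forall>\<^sub>F n in sequentially. 1 / real (Suc n) < e"
        using LIMSEQ_inverse_real_of_nat \<open>0 < e\<close>
        by (auto simp: inverse_eq_divide dest: order_tendstoD(2))
      then have "\<forall>\<^sub>F n in sequentially. f n y \<le> f n x + ((y - x) + e)"
      proof eventually_elim
        case (elim n)
        then show ?case
          using f_lip[OF that, of n] by linarith
      qed
      then show "q y \<le> q x + (y - x) + e"
        using q_le[of y x "(y - x) + e"] by simp
    qed
    show "q x = 0" if "x \<le> 0" for x
    proof -
      have nonpos: "x * real (Suc n) \<le> 0" for n
        using that by (intro mult_nonpos_nonneg) auto
      have "nat \<lfloor>x * real (Suc n)\<rfloor> = 0" for n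
        using floor_mono[OF nonpos[of n]] by (simp only: floor_zero nat_0_iff)
      then have "f n x = 0" for n
        unfolding f_def using zero by simp
      then show ?thesis
        by (simp add: q_def zero_ereal_def[symmetric] Limsup_const)
    qed
    show "q x \<le> m" for x
    proof -
      obtain r where "(\<lambda>j. f (r j) x) \<longlonglongrightarrow> q x"
        using subseq by blast
      then show ?thesis
        by (rule LIMSEQ_le_const2) (auto simp: f_def le)
    qed
    show "\<exists>r. strict_mono r \<and> (\<lambda>j. a (r j) (nat \<lfloor>x * real (Suc (r j))\<rfloor>)) \<longlonglongrightarrow> q x" for x
      using subseq[of x] by (simp add: f_def)
  qed
qed

section \<open>Allocations and rewards along an instance\<close>

definition total_allocation :: "(request list \<Rightarrow> real) \<Rightarrow> request list \<Rightarrow> real" where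
  "total_allocation A I = (\<Sum>t<length I. allocation A I t)"

lemma total_allocation_Nil [simp]: "total_allocation A [] = 0"
  by (simp add: total_allocation_def)

lemma reward_Nil [simp]: "reward rl rh A [] = 0"
  by (simp add: reward_def)

lemma total_allocation_snoc:
  "total_allocation A (I @ [r]) = total_allocation A I + A (I @ [r])"
  by (simp add: total_allocation_def allocation_def)

lemma reward_snoc:
  "reward rl rh A (I @ [r]) = reward rl rh A I + unit_reward rl rh (snd r) * A (I @ [r])"
  by (simp add: reward_def allocation_def nth_append)

lemma demand_append [simp]: "demand z (I @ J) = demand z I + demand z J"
  by (simp add: demand_def)

lemma demand_replicate_Low:
  "demand Low (replicate k (s, Low)) = real k * s" "demand High (replicate k (s, Low)) = 0"
  by (simp_all add: demand_def sum_list_replicate)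

lemma valid_instance_append [simp]:
  "valid_instance (I @ J) \<longleftrightarrow> valid_instance I \<and> valid_instance J"
  by (auto simp: valid_instance_def)

lemma online_algorithm_snoc:
  assumes "online_algorithm m A" "valid_instance (I @ [r])"
  shows "0 \<le> A (I @ [r])" "A (I @ [r]) \<le> fst r" "A (I @ [r]) \<le> m - total_allocation A I"
proof -
  have "\<forall>t<length (I @ [r]). 0 \<le> allocation A (I @ [r]) t \<and> allocation A (I @ [r]) t \<le> fst ((I @ [r]) ! t)
      \<and> allocation A (I @ [r]) t \<le> m - (\<Sum>i<t. allocation A (I @ [r]) i)"
    using assms unfolding online_algorithm_def by blast
  then have "0 \<le> allocation A (I @ [r]) (length I) \<and> allocation A (I @ [r]) (length I) \<le> fst r
      \<and> allocation A (I @ [r]) (length I) \<le> m - (\<Sum>i<length I. allocation A (I @ [r]) i)"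
    by (auto dest!: spec[of _ "length I"])
  moreover have "(\<Sum>i<length I. allocation A (I @ [r]) i) = total_allocation A I"
    by (simp add: total_allocation_def allocation_def)
  ultimately show "0 \<le> A (I @ [r])" "A (I @ [r]) \<le> fst r" "A (I @ [r]) \<le> m - total_allocation A I"
    by (simp_all add: allocation_def)
qed

lemma total_allocation_bounds:
  assumes "online_algorithm m A" "valid_instance I" "0 \<le> m"
  shows "0 \<le> total_allocation A I \<and> total_allocation A I \<le> m"
  using assms(2)
proof (induction I rule: rev_induct)
  case (snoc r I)
  then show ?case
    using online_algorithm_snoc[OF assms(1) snoc.prems] by (simp add: total_allocation_snoc)
qed (use assms in simp)

lemma reward_bounds:
  assumes "online_algorithm m A" "valid_instance I" "0 \<le> rl" "rl \<le> rh"
  shows "0 \<le> reward rl rh A I \<and> reward rl rh A I \<le> rh * total_allocation A I"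
  using assms(2)
proof (induction I rule: rev_induct)
  case (snoc r I)
  have A: "0 \<le> A (I @ [r])"
    by (rule online_algorithm_snoc[OF assms(1) snoc.prems])
  have "0 \<le> unit_reward rl rh (snd r)" "unit_reward rl rh (snd r) \<le> rh"
    using assms by (cases "snd r"; simp)+
  then have "0 \<le> unit_reward rl rh (snd r) * A (I @ [r])"
    "unit_reward rl rh (snd r) * A (I @ [r]) \<le> rh * A (I @ [r])"
    using A by (auto intro: mult_right_mono)
  then show ?case
    using snoc by (simp add: reward_snoc total_allocation_snoc distrib_left)
qed simp

lemma reward_replicate_Low:
  "reward rl rh A (replicate k (s, Low)) = rl * total_allocation A (replicate k (s, Low))"
proof (induction k)
  case (Suc k)
  have "replicate (Suc k) (s, Low) = replicate k (s, Low) @ [(s, Low)]"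
    by (simp add: replicate_append_same)
  then show ?case
    using Suc by (simp add: reward_snoc total_allocation_snoc distrib_left del: replicate_Suc)
qed simp

text \<open>The request of size \<open>s\<close> fills the gap left by the discretization, so that
  the demand vector is exactly the intended point. Empty requests are omitted because valid sizes
  are positive.\<close>

definition low_high_instance :: "real \<Rightarrow> nat \<Rightarrow> real \<Rightarrow> real \<Rightarrow> request list" where
  "low_high_instance d k s y =
     replicate k (d, Low) @ (if 0 < s then [(s, Low)] else []) @ (if 0 < y then [(y, High)] else [])"

lemma low_high_instance_props:
  assumes "0 < d" "0 \<le> s" "0 \<le> y"
  shows "valid_instance (low_high_instance d k s y)"
    and "demand Low (low_high_instance d k s y) = real k * d + s"
    and "demand High (low_high_instance d k s y) = y"
proof -
  show "valid_instance (low_high_instance d k s y)"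
    using assms by (auto simp: low_high_instance_def valid_instance_def)
  show "demand Low (low_high_instance d k s y) = real k * d + s"
    using assms by (simp add: low_high_instance_def demand_replicate_Low) (simp add: demand_def)
  show "demand High (low_high_instance d k s y) = y"
    using assms by (simp add: low_high_instance_def demand_replicate_Low) (simp add: demand_def)
qed

section \<open>Rewards on instances with low requests first\<close>

context allocation_problem
begin

text \<open>The gap-filling request earns at most \<open>d * rl\<close> and can only reduce the room
  left for high demand below \<open>m - T\<close>.\<close>

lemma reward_low_high_instance_le:
  fixes k :: nat
  assumes A: "online_algorithm m A" and "0 < d" "0 \<le> s" "s \<le> d" "0 \<le> y"
  defines "T \<equiv> total_allocation A (replicate k (d, Low))"
  shows "reward rl rh A (low_high_instance d k s y) \<le> (T + d) * rl + min y (m - T) * rh"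
proof -
  define J where "J = replicate k (d, Low) @ (if 0 < s then [(s, Low)] else [])"
  have valid: "valid_instance J" "valid_instance (replicate k (d, Low))"
    using assms by (auto simp: J_def valid_instance_def)
  have T: "0 \<le> T" "T \<le> m"
    unfolding T_def using total_allocation_bounds[OF A valid(2)] m_pos by auto
  have J: "T \<le> total_allocation A J \<and> reward rl rh A J \<le> (T + d) * rl"
  proof (cases "0 < s")
    case True
    then have J: "J = replicate k (d, Low) @ [(s, Low)]"
      by (simp add: J_def)
    have "valid_instance (replicate k (d, Low) @ [(s, Low)])"
      using valid(1) by (simp only: J)
    note bd = online_algorithm_snoc[OF A this]
    have "rl * A (replicate k (d, Low) @ [(s, Low)]) \<le> rl * d"
      using bd(2) rl_pos assms by (intro mult_left_mono) auto
    then show ?thesis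
      using bd(1)
      by (simp add: J reward_snoc reward_replicate_Low total_allocation_snoc T_def algebra_simps)
  next
    case False
    then show ?thesis
      using assms rl_pos by (simp add: J_def reward_replicate_Low T_def algebra_simps)
  qed
  have "reward rl rh A (low_high_instance d k s y) \<le> reward rl rh A J + min y (m - T) * rh"
  proof (cases "0 < y")
    case True
    then have I: "low_high_instance d k s y = J @ [(y, High)]"
      by (simp add: low_high_instance_def J_def)
    have "valid_instance (J @ [(y, High)])"
      using valid True by (auto simp: valid_instance_def)
    note bd = online_algorithm_snoc[OF A this]
    have "A (J @ [(y, High)]) * rh \<le> min y (m - T) * rh"
      using bd(2,3) J rh_pos by (intro mult_right_mono) auto
    then show ?thesis
      by (simp add: I reward_snoc mult.commute)
  next
    case False
    then have "low_high_instance d k s y = J"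
      by (simp add: low_high_instance_def J_def)
    then show ?thesis
      using assms T rh_pos by simp
  qed
  then show ?thesis
    using J by linarith
qed

text \<open>Jensen's inequality for the concave \<open>min\<close>: bounding
  \<open>min y (m - T)\<close> by either argument before integrating gives two estimates that are
  affine in the allocation, and their minimum is the claim.\<close>

lemma randomized_reward_low_high_instance_le:
  assumes A: "randomized_online_algorithm m M A" and "0 < d" "0 \<le> s" "s \<le> d" "0 \<le> y"
  defines "T \<equiv> \<lambda>k. \<integral>\<omega>. total_allocation (A \<omega>) (replicate k (d, Low)) \<partial>M"
  shows "expected_reward rl rh M A (low_high_instance d k s y) \<le> (T k + d) * rl + min y (m - T k) * rh"
    and "T 0 = 0" "T k \<le> T (Suc k)" "T (Suc k) \<le> T k + d" "T k \<le> m"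
proof -
  interpret prob_space M
    using A by (simp add: randomized_online_algorithm_def)
  have online: "online_algorithm m (A \<omega>)" if "\<omega> \<in> space M" for \<omega>
    using A that by (simp add: randomized_online_algorithm_def)
  have meas: "(\<lambda>\<omega>. allocation (A \<omega>) I t) \<in> borel_measurable M"
    if "valid_instance I" "t < length I" for I t
  proof -
    have "valid_instance (take (Suc t) I)" "take (Suc t) I \<noteq> []"
      using that by (auto simp: valid_instance_def dest: in_set_takeD)
    then show ?thesis
      using A by (simp add: randomized_online_algorithm_def allocation_def)
  qed
  have int_total: "integrable M (\<lambda>\<omega>. total_allocation (A \<omega>) I)" if I: "valid_instance I" for I
  proof (rule integrable_const_bound[where B = m])
    show "AE \<omega> in M. norm (total_allocation (A \<omega>) I) \<le> m"
      using total_allocation_bounds[OF online I] m_pos by (intro AE_I2) auto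
    show "(\<lambda>\<omega>. total_allocation (A \<omega>) I) \<in> borel_measurable M"
      unfolding total_allocation_def by (intro borel_measurable_sum meas I) auto
  qed
  have int_reward: "integrable M (\<lambda>\<omega>. reward rl rh (A \<omega>) I)" if I: "valid_instance I" for I
  proof (rule integrable_const_bound[where B = "rh * m"])
    show "AE \<omega> in M. norm (reward rl rh (A \<omega>) I) \<le> rh * m"
    proof (rule AE_I2)
      fix \<omega> assume \<omega>: "\<omega> \<in> space M"
      have "rh * total_allocation (A \<omega>) I \<le> rh * m"
        using total_allocation_bounds[OF online[OF \<omega>] I] m_pos rh_pos by (intro mult_left_mono) auto
      then show "norm (reward rl rh (A \<omega>) I) \<le> rh * m"
        using reward_bounds[OF online[OF \<omega>] I, of rl rh] rl_pos rl_less_rh 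
        unfolding real_norm_def by linarith
    qed
    show "(\<lambda>\<omega>. reward rl rh (A \<omega>) I) \<in> borel_measurable M"
      unfolding reward_def by (intro borel_measurable_sum borel_measurable_times borel_measurable_const meas I) auto
  qed
  have valid: "valid_instance (replicate k (d, Low))" for k
    using \<open>0 < d\<close> by (auto simp: valid_instance_def)
  note int_T = int_total[OF valid]
  let ?I = "low_high_instance d k s y"
  note int_R = int_reward[OF low_high_instance_props(1)[OF \<open>0 < d\<close> \<open>0 \<le> s\<close> \<open>0 \<le> y\<close>, of k]]
  let ?T = "\<lambda>\<omega>. total_allocation (A \<omega>) (replicate k (d, Low))"
  note le = reward_low_high_instance_le[OF online \<open>0 < d\<close> \<open>0 \<le> s\<close> \<open>s \<le> d\<close> \<open>0 \<le> y\<close>, of _ k]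
  have "expected_reward rl rh M A ?I \<le> (\<integral>\<omega>. ?T \<omega> * rl + (d * rl + y * rh) \<partial>M)"
    unfolding expected_reward_def
  proof (rule integral_mono[OF int_R])
    show "integrable M (\<lambda>\<omega>. ?T \<omega> * rl + (d * rl + y * rh))"
      using int_T by simp
    fix \<omega> assume \<omega>: "\<omega> \<in> space M"
    have "min y (m - ?T \<omega>) * rh \<le> y * rh"
      using rh_pos by (intro mult_right_mono) auto
    with le[OF \<omega>] show "reward rl rh (A \<omega>) ?I \<le> ?T \<omega> * rl + (d * rl + y * rh)"
      by (simp add: algebra_simps)
  qed
  also have "\<dots> = T k * rl + (d * rl + y * rh)"
    using int_T by (simp add: T_def prob_space)
  finally have 1: "expected_reward rl rh M A ?I \<le> (T k + d) * rl + y * rh"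
    by (simp add: algebra_simps)
  have "expected_reward rl rh M A ?I \<le> (\<integral>\<omega>. ?T \<omega> * (rl - rh) + (d * rl + m * rh) \<partial>M)"
    unfolding expected_reward_def
  proof (rule integral_mono[OF int_R])
    show "integrable M (\<lambda>\<omega>. ?T \<omega> * (rl - rh) + (d * rl + m * rh))"
      using int_T by simp
    fix \<omega> assume \<omega>: "\<omega> \<in> space M"
    have "min y (m - ?T \<omega>) * rh \<le> (m - ?T \<omega>) * rh"
      using rh_pos by (intro mult_right_mono) auto
    with le[OF \<omega>] show "reward rl rh (A \<omega>) ?I \<le> ?T \<omega> * (rl - rh) + (d * rl + m * rh)"
      by (simp add: algebra_simps)
  qed
  also have "\<dots> = T k * (rl - rh) + (d * rl + m * rh)"
    using int_T by (simp add: T_def prob_space)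
  finally have 2: "expected_reward rl rh M A ?I \<le> (T k + d) * rl + (m - T k) * rh"
    by (simp add: algebra_simps)
  show "expected_reward rl rh M A ?I \<le> (T k + d) * rl + min y (m - T k) * rh"
    using 1 2 by (simp add: min_def)
  show "T 0 = 0"
    by (simp add: T_def)
  have snoc: "replicate (Suc k) (d, Low) = replicate k (d, Low) @ [(d, Low)]"
    by (simp add: replicate_append_same)
  have step: "?T \<omega> \<le> total_allocation (A \<omega>) (replicate (Suc k) (d, Low))"
    "total_allocation (A \<omega>) (replicate (Suc k) (d, Low)) \<le> ?T \<omega> + d" if "\<omega> \<in> space M" for \<omega>
    using online_algorithm_snoc[OF online[OF that] valid[of "Suc k", unfolded snoc]]
    unfolding snoc total_allocation_snoc by simp_all
  show "T k \<le> T (Suc k)"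
    unfolding T_def by (intro integral_mono int_T step)
  have "T (Suc k) \<le> (\<integral>\<omega>. ?T \<omega> + d \<partial>M)"
    unfolding T_def by (intro integral_mono int_T step Bochner_Integration.integrable_add integrable_const)
  then show "T (Suc k) \<le> T k + d"
    using int_T by (simp add: T_def prob_space)
  have "T k \<le> (\<integral>\<omega>. m \<partial>M)"
    unfolding T_def using total_allocation_bounds[OF online valid] m_pos
    by (intro integral_mono int_T integrable_const) auto
  then show "T k \<le> m"
    by (simp add: prob_space)
qed

end

section \<open>The upper bound for every online algorithm\<close>

context ml_region
begin

text \<open>Expected allocations to ever finer low requests have a limit \<open>q\<close>, and the
  consistent ratio of the algorithm is one of the ratios to which \<open>le_C_star\<close> applies
  with this \<open>q\<close>.\<close>

lemma consistent_ratio_expected_le_C_star: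
  assumes A: "randomized_online_algorithm m M A"
  shows "consistent_ratio m rl rh R (expected_reward rl rh M A) \<le> C_star m rl rh R"
proof -
  let ?Rew = "expected_reward rl rh M A"
  let ?ratios = "{ratio (?Rew I) (OPT m rl rh I) | I. valid_instance I \<and> (demand Low I, demand High I) \<in> R}"
  define C where "C = consistent_ratio m rl rh R ?Rew"
  have Rew: "0 \<le> ?Rew I" if I: "valid_instance I" for I
    unfolding expected_reward_def
  proof (rule integral_nonneg_AE, rule AE_I2)
    fix \<omega> assume "\<omega> \<in> space M"
    then have "online_algorithm m (A \<omega>)"
      using A by (simp add: randomized_online_algorithm_def)
    then show "0 \<le> reward rl rh (A \<omega>) I"
      using reward_bounds[OF _ I] rl_pos rl_less_rh by simp
  qed
  have ratio_nonneg: "0 \<le> r" if "r \<in> ?ratios" for r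
    using that Rew opt_nonneg nonneg_R by (fastforce simp: OPT_def ratio_def)
  then have C_le: "C \<le> ratio (?Rew I) (OPT m rl rh I)"
    if "valid_instance I" "(demand Low I, demand High I) \<in> R" for I
    unfolding C_def consistent_ratio_def
    by (intro cInf_lower bdd_belowI[of _ 0]) (use that in auto)
  define d where "d n = 1 / real (Suc n)" for n
  define T where "T n k = (\<integral>\<omega>. total_allocation (A \<omega>) (replicate k (d n, Low)) \<partial>M)" for n k
  have d: "0 < d n" for n
    by (simp add: d_def)
  note T = randomized_reward_low_high_instance_le[OF A d, folded T_def]
  note T_props = T(2-)[OF order_refl less_imp_le[OF d] order_refl]
  obtain q where q: "\<And>x y. x \<le> y \<Longrightarrow> q x \<le> q y" "\<And>x y. x \<le> y \<Longrightarrow> q y \<le> q x + (y - x)"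
      "\<And>x. x \<le> 0 \<Longrightarrow> q x = 0" "\<And>x. q x \<le> m"
      and lim: "\<And>x. \<exists>r. strict_mono r \<and> (\<lambda>j. T (r j) (nat \<lfloor>x * real (Suc (r j))\<rfloor>)) \<longlonglongrightarrow> q x"
  proof (rule lipschitz_limit_of_discretizations[of T m])
    show "T n 0 = 0" "T n k \<le> T n (Suc k)" "T n (Suc k) \<le> T n k + 1 / real (Suc n)" "T n k \<le> m" for n k
      by (rule T_props[unfolded d_def])+
  qed blast
  have q_bounds: "0 \<le> q x" "q x \<le> x" if "0 \<le> x" for x
    using q(1,2)[OF that] q(3)[of 0] by auto
  have key: "K * opt m rl rh (x, y) \<le> low_first_reward m rl rh (q x) y"
    if xy: "(x, y) \<in> R" and K: "\<And>I. valid_instance I \<Longrightarrow> demand Low I = x \<Longrightarrow> demand High I = y \<Longrightarrow>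
       K * opt m rl rh (x, y) \<le> ?Rew I" for x y K
  proof -
    have nn: "0 \<le> x" "0 \<le> y"
      using nonneg_R[OF xy] by auto
    obtain r where r: "strict_mono r" "(\<lambda>j. T (r j) (nat \<lfloor>x * real (Suc (r j))\<rfloor>)) \<longlonglongrightarrow> q x"
      using lim by blast
    have le: "K * opt m rl rh (x, y) \<le> (T n (nat \<lfloor>x * real (Suc n)\<rfloor>) + d n) * rl
        + min y (m - T n (nat \<lfloor>x * real (Suc n)\<rfloor>)) * rh" for n
    proof -
      let ?k = "nat \<lfloor>x * real (Suc n)\<rfloor>"
      have k: "real ?k \<le> x * real (Suc n)" "x * real (Suc n) \<le> real ?k + 1"
        using nn by (simp_all add: of_nat_nat del: of_nat_Suc)
      \<comment> \<open>The gap after \<open>?k\<close> requests of size \<open>d n\<close>;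
        rounding down places it between 0 and \<open>d n\<close>.\<close>
      let ?s = "x - real ?k * d n"
      have "?s = (x * real (Suc n) - real ?k) / real (Suc n)"
        by (simp add: d_def diff_divide_distrib del: of_nat_Suc)
      moreover have "0 \<le> (x * real (Suc n) - real ?k) / real (Suc n)"
        using k by (intro divide_nonneg_nonneg) linarith+
      moreover have "(x * real (Suc n) - real ?k) / real (Suc n) \<le> d n"
        unfolding d_def using k by (intro divide_right_mono) linarith+
      ultimately have s: "0 \<le> ?s" "?s \<le> d n"
        by (simp_all only:)
      have "K * opt m rl rh (x, y) \<le> ?Rew (low_high_instance (d n) ?k ?s y)"
        using low_high_instance_props[OF d[of n] s(1) nn(2), of ?k] by (intro K) auto
      also have "\<dots> \<le> (T n ?k + d n) * rl + min y (m - T n ?k) * rh"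
        by (rule T(1)[OF s nn(2)])
      finally show ?thesis .
    qed
    have "d \<longlonglongrightarrow> 0"
      unfolding d_def using LIMSEQ_inverse_real_of_nat by (simp add: inverse_eq_divide)
    then have "(\<lambda>j. d (r j)) \<longlonglongrightarrow> 0"
      using LIMSEQ_subseq_LIMSEQ[OF _ r(1)] by (auto simp: o_def)
    with r(2) have "(\<lambda>j. (T (r j) (nat \<lfloor>x * real (Suc (r j))\<rfloor>) + d (r j)) * rl
        + min y (m - T (r j) (nat \<lfloor>x * real (Suc (r j))\<rfloor>)) * rh)
        \<longlonglongrightarrow> (q x + 0) * rl + min y (m - q x) * rh"
      by (intro tendsto_intros)
    then show ?thesis
      unfolding low_first_reward_def add_0_right by (rule LIMSEQ_le_const) (use le in blast)
  qed
  \<comment> \<open>An actual instance is needed for the infimum to range over a nonempty set. A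
    single request per type suffices.\<close>
  obtain x0 y0 where R0: "(x0, y0) \<in> R"
    using nonempty_R by auto
  have nn0: "0 \<le> x0" "0 \<le> y0"
    using nonneg_R[OF R0] by auto
  let ?I0 = "low_high_instance 1 0 x0 y0"
  have I0: "valid_instance ?I0" "demand Low ?I0 = x0" "demand High ?I0 = y0"
    using low_high_instance_props[of 1 x0 y0 0] nn0 by auto
  have "0 \<le> C"
    unfolding C_def consistent_ratio_def
    by (rule cInf_greatest) (use I0 R0 ratio_nonneg in auto)
  have C_opt: "C * opt m rl rh (x, y) \<le> ?Rew I"
    if "valid_instance I" "demand Low I = x" "demand High I = y" "(x, y) \<in> R" for I x y
    using C_le[of I] Rew[OF that(1)] opt_nonneg[of x y] nonneg_R[OF that(4)] that
    by (auto simp: OPT_def ratio_def pos_le_divide_eq split: if_splits)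
  then have reward: "C * opt m rl rh (x, y) \<le> low_first_reward m rl rh (q x) y" if "(x, y) \<in> R" for x y
    using that by (intro key) auto
  \<comment> \<open>One point of the region is enough: either its ratio is 1 by default, or the
    low-first reward there is at most the optimum.\<close>
  have "C \<le> 1"
  proof (cases "opt m rl rh (x0, y0) = 0")
    case True
    then show ?thesis
      using C_le[OF I0(1)] I0 R0 by (simp add: OPT_def ratio_def)
  next
    case False
    then have "0 < opt m rl rh (x0, y0)"
      using opt_nonneg[OF nn0] by simp
    moreover have "C * opt m rl rh (x0, y0) \<le> 1 * opt m rl rh (x0, y0)"
      using reward[OF R0] low_first_reward_le_opt[OF nn0 q_bounds[OF nn0(1)] q(4)] by simp
    ultimately show ?thesis
      by (simp only: mult_le_cancel_right_pos)
  qed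
  with \<open>0 \<le> C\<close> have "C \<le> C_star m rl rh R"
    by (rule le_C_star[OF _ _ q reward])
  then show ?thesis
    by (simp add: C_def)
qed

text \<open>A deterministic algorithm is a randomized one over a one-point probability
  space.\<close>

lemma consistent_ratio_le_C_star:
  assumes A: "online_algorithm m A"
  shows "consistent_ratio m rl rh R (reward rl rh A) \<le> C_star m rl rh R"
proof -
  let ?M = "return (count_space UNIV) ()"
  have "randomized_online_algorithm m ?M (\<lambda>_. A)"
    using A by (auto simp: randomized_online_algorithm_def intro: prob_space_return)
  moreover have "expected_reward rl rh ?M (\<lambda>_. A) = reward rl rh A"
    unfolding expected_reward_def by (rule ext, rule integral_return) simp_all
  ultimately show ?thesis
    using consistent_ratio_expected_le_C_star[of ?M "\<lambda>_. A"] by simp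
qed

end

theorem theorem6:
  fixes m rl rh :: real and R :: "(real \<times> real) set"
  assumes "0 < m" and "0 < rl" and "rl < rh"
    and "convex R" and "compact R" and "R \<noteq> {}"
    and "\<forall>(x, y)\<in>R. 0 \<le> x \<and> 0 \<le> y"
  shows "(\<forall>A. online_algorithm m A \<longrightarrow>
            consistent_ratio m rl rh R (reward rl rh A) \<le> C_star m rl rh R)
       \<and> (\<forall>(M :: 'w measure) A. randomized_online_algorithm m M A \<longrightarrow>
            consistent_ratio m rl rh R (expected_reward rl rh M A) \<le> C_star m rl rh R)
       \<and> 1 / (2 - rl / rh) \<le> C_star m rl rh R"
proof -
  interpret ml_region m rl rh R
    by unfold_locales (use assms in auto)
  show ?thesis
    using consistent_ratio_le_C_star consistent_ratio_expected_le_C_star rho_le_C_star by blast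
qed

end
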